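(* Let $\hbar>0$ and let $K\in\ell^1(\mathbb Z)$ satisfy $K(-\alpha)=K(\alpha)\in\mathbb R$ for all $\alpha\in\mathbb Z$. Define $H$ on $\ell^2(\mathbb Z)$ by $(H\psi)_n=\hbar\sum_{\alpha\in\mathbb Z}K(\alpha)\psi_{n-\alpha}$. Then: (i) $H$ is bounded with $\|H\|\le\hbar\|K\|_{\ell^1}$, and $H$ is self-adjoint. (ii) Under the unitary discrete Fourier transform $\mathcal F$, $H$ is diagonal: for $\psi\in\ell^2(\mathbb Z)$, $$(\mathcal FH\psi)(k)=E(k)(\mathcal F\psi)(k),\qquad E(k)=\hbar\sum_{\alpha\in\mathbb Z}K(\alpha)e^{-ik\alpha},$$ where $E$ is real-valued, continuous and $2\pi$-periodic. (iii) The unitary group $U(t):=e^{-\frac i\hbar Ht}$ exists for all $t\in\mathbb R$ and $(\mathcal FU(t)\psi)(k)=e^{-\frac i\hbar E(k)t}(\mathcal F\psi)(k)$. Its kernel $\Omega_t(n,m):=\langle n|U(t)|m\rangle$ depends only on $n-m$ and is given by $$\Omega_t(n,m)=\frac1{2\pi}\int_{-\pi}^{\pi}e^{ik(n-m)}e^{-\frac i\hbar E(k)t}\,dk .$$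
   Context: $\{|n\rangle\}_{n\in\mathbb Z}$ is the canonical basis of $\ell^2(\mathbb Z)$; the inner product is linear in the second entry. $\mathcal F:\ell^2(\mathbb Z)\to L^2((-\pi,\pi],\tfrac{dk}{2\pi})$ is the unitary map $(\mathcal F\psi)(k)=\sum_{n}\psi_ne^{-ikn}$ (series in the $L^2$ sense), with inverse $\psi_n=\frac1{2\pi}\int_{-\pi}^{\pi}(\mathcal F\psi)(k)e^{ikn}dk$. Identities between functions of $k$ in $L^2$ hold for almost every $k$. *)

theory Defs
  imports "HOL-Analysis.Analysis"
begin

section \<open>The Hilbert space of square-summable sequences on the integers\<close>

typedef ell2 = "{\<psi> :: int \<Rightarrow> complex. (\<lambda>n. (cmod (\<psi> n))\<^sup>2) summable_on UNIV}"
  morphisms coord Abs_ell2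
  by (intro exI[of _ "\<lambda>_. 0"]) simp

setup_lifting type_definition_ell2

lemma ell2_eqI: "(\<And>n. coord \<phi> n = coord \<psi> n) \<Longrightarrow> \<phi> = \<psi>"
  by (simp add: coord_inject[symmetric] ext)

lemma summable_coord: "(\<lambda>n. (cmod (coord \<psi> n))\<^sup>2) summable_on UNIV"
  using coord[of \<psi>] by simp

lemma summable_on_le:
  fixes f g :: "'i \<Rightarrow> real"
  assumes "g summable_on A" "\<And>n. n \<in> A \<Longrightarrow> 0 \<le> f n" "\<And>n. n \<in> A \<Longrightarrow> f n \<le> g n"
  shows "f summable_on A"
proof -
  have "(\<lambda>n. norm (g n)) summable_on A"
    using summable_on_iff_abs_summable_on_real[of g A] assms(1) by simp
  then have "(\<lambda>n. norm (f n)) summable_on A"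
    by (rule Infinite_Sum.abs_summable_on_comparison_test) (use assms in force)
  then show ?thesis
    by (rule abs_summable_summable)
qed

lemma summable_square_add:
  fixes \<phi> \<psi> :: "int \<Rightarrow> complex"
  assumes "(\<lambda>n. (cmod (\<phi> n))\<^sup>2) summable_on UNIV" "(\<lambda>n. (cmod (\<psi> n))\<^sup>2) summable_on UNIV"
  shows "(\<lambda>n. (cmod (\<phi> n + \<psi> n))\<^sup>2) summable_on UNIV"
proof (rule summable_on_le)
  show "(\<lambda>n. 2 * (cmod (\<phi> n))\<^sup>2 + 2 * (cmod (\<psi> n))\<^sup>2) summable_on UNIV"
    by (intro summable_on_add summable_on_cmult_right assms)
  fix n
  have "(cmod (\<phi> n + \<psi> n))\<^sup>2 \<le> (cmod (\<phi> n) + cmod (\<psi> n))\<^sup>2"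
    by (intro power_mono norm_triangle_ineq) simp
  also have "\<dots> \<le> 2 * (cmod (\<phi> n))\<^sup>2 + 2 * (cmod (\<psi> n))\<^sup>2"
    using sum_squares_bound[of "cmod (\<phi> n)" "cmod (\<psi> n)"] by (simp add: power2_sum)
  finally show "(cmod (\<phi> n + \<psi> n))\<^sup>2 \<le> 2 * (cmod (\<phi> n))\<^sup>2 + 2 * (cmod (\<psi> n))\<^sup>2" .
qed simp

lift_definition cscale :: "complex \<Rightarrow> ell2 \<Rightarrow> ell2" is "\<lambda>c \<psi> n. c * \<psi> n"
  by (simp add: norm_mult power_mult_distrib summable_on_cmult_right)

instantiation ell2 :: real_vector
begin
lift_definition zero_ell2 :: ell2 is "\<lambda>_. 0" by simp
lift_definition plus_ell2 :: "ell2 \<Rightarrow> ell2 \<Rightarrow> ell2" is "\<lambda>\<phi> \<psi> n. \<phi> n + \<psi> n"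
  by (simp add: summable_square_add)
lift_definition uminus_ell2 :: "ell2 \<Rightarrow> ell2" is "\<lambda>\<psi> n. - \<psi> n" by simp
lift_definition minus_ell2 :: "ell2 \<Rightarrow> ell2 \<Rightarrow> ell2" is "\<lambda>\<phi> \<psi> n. \<phi> n - \<psi> n"
  subgoal for \<phi> \<psi> using summable_square_add[of \<phi> "\<lambda>n. - \<psi> n"] by simp
  done
definition scaleR_ell2 :: "real \<Rightarrow> ell2 \<Rightarrow> ell2" where
  "scaleR_ell2 r = cscale (complex_of_real r)"

lemma coord_scaleR [simp]: "coord (r *\<^sub>R \<psi>) n = r *\<^sub>R coord \<psi> n"
  by (simp add: scaleR_ell2_def cscale.rep_eq scaleR_conv_of_real)

instance
  by standard
    (auto intro!: ell2_eqI
      simp: zero_ell2.rep_eq plus_ell2.rep_eq uminus_ell2.rep_eq minus_ell2.rep_eq algebra_simps)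
end

lemmas coord_simps [simp] =
  zero_ell2.rep_eq plus_ell2.rep_eq uminus_ell2.rep_eq minus_ell2.rep_eq cscale.rep_eq

definition cinner :: "ell2 \<Rightarrow> ell2 \<Rightarrow> complex" where
  "cinner \<phi> \<psi> = (\<Sum>\<^sub>\<infinity>n. cnj (coord \<phi> n) * coord \<psi> n)"

lemma summable_cinner: "(\<lambda>n. cnj (coord \<phi> n) * coord \<psi> n) summable_on UNIV"
proof (rule abs_summable_summable, rule summable_on_le)
  show "(\<lambda>n. (cmod (coord \<phi> n))\<^sup>2 + (cmod (coord \<psi> n))\<^sup>2) summable_on UNIV"
    by (intro summable_on_add summable_coord)
  fix n
  have "cmod (coord \<phi> n) * cmod (coord \<psi> n) \<le> 2 * cmod (coord \<phi> n) * cmod (coord \<psi> n)"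
    by simp
  also have "\<dots> \<le> (cmod (coord \<phi> n))\<^sup>2 + (cmod (coord \<psi> n))\<^sup>2"
    by (rule sum_squares_bound)
  finally show "norm (cnj (coord \<phi> n) * coord \<psi> n) \<le> (cmod (coord \<phi> n))\<^sup>2 + (cmod (coord \<psi> n))\<^sup>2"
    by (simp add: norm_mult)
qed simp

lemma cinner_commute: "cinner \<psi> \<phi> = cnj (cinner \<phi> \<psi>)"
  unfolding cinner_def by (subst infsum_cnj[symmetric]) (simp add: mult.commute)

lemma cinner_add_left: "cinner (\<phi> + \<psi>) \<xi> = cinner \<phi> \<xi> + cinner \<psi> \<xi>"
  unfolding cinner_def by (simp add: distrib_right infsum_add summable_cinner)

lemma cinner_cscale_left: "cinner (cscale c \<phi>) \<psi> = cnj c * cinner \<phi> \<psi>"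
  unfolding cinner_def by (simp add: infsum_cmult_right' mult.assoc)

lemma cinner_cscale_right: "cinner \<phi> (cscale c \<psi>) = c * cinner \<phi> \<psi>"
  unfolding cinner_def by (simp add: infsum_cmult_right'[symmetric] mult.left_commute)

lemma cinner_self: "cinner \<psi> \<psi> = complex_of_real (\<Sum>\<^sub>\<infinity>n. (cmod (coord \<psi> n))\<^sup>2)"
proof -
  have "((\<lambda>n. complex_of_real ((cmod (coord \<psi> n))\<^sup>2)) has_sum
      complex_of_real (\<Sum>\<^sub>\<infinity>n. (cmod (coord \<psi> n))\<^sup>2)) UNIV"
    using has_sum_bounded_linear[OF bounded_linear_of_real has_sum_infsum[OF summable_coord]]
    by blast
  moreover have "cnj z * z = complex_of_real ((cmod z)\<^sup>2)" for z
    by (metis complex_norm_square mult.commute)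
  ultimately show ?thesis
    unfolding cinner_def by (simp add: infsumI)
qed

text \<open>The underlying real inner product space. Its inner product is the real part of
  the complex one, so the norm is the usual one.\<close>

instantiation ell2 :: real_inner
begin
definition inner_ell2 :: "ell2 \<Rightarrow> ell2 \<Rightarrow> real" where
  "inner_ell2 \<phi> \<psi> = Re (cinner \<phi> \<psi>)"
definition norm_ell2 :: "ell2 \<Rightarrow> real" where
  "norm_ell2 \<psi> = sqrt (\<Sum>\<^sub>\<infinity>n. (cmod (coord \<psi> n))\<^sup>2)"
definition sgn_ell2 :: "ell2 \<Rightarrow> ell2" where
  "sgn_ell2 \<psi> = \<psi> /\<^sub>R norm \<psi>"
definition dist_ell2 :: "ell2 \<Rightarrow> ell2 \<Rightarrow> real" where
  "dist_ell2 \<phi> \<psi> = norm (\<phi> - \<psi>)"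
definition uniformity_ell2 :: "(ell2 \<times> ell2) filter" where
  "uniformity_ell2 = (INF e\<in>{0<..}. principal {(\<phi>, \<psi>). dist \<phi> \<psi> < e})"
definition open_ell2 :: "ell2 set \<Rightarrow> bool" where
  "open_ell2 S \<longleftrightarrow> (\<forall>\<psi>\<in>S. \<forall>\<^sub>F (\<psi>', \<phi>) in uniformity. \<psi>' = \<psi> \<longrightarrow> \<phi> \<in> S)"

instance
proof
  fix \<phi> \<psi> \<xi> :: ell2 and r :: real
  show "inner \<phi> \<psi> = inner \<psi> \<phi>"
    by (simp add: inner_ell2_def cinner_commute[of \<phi> \<psi>])
  show "inner (\<phi> + \<psi>) \<xi> = inner \<phi> \<xi> + inner \<psi> \<xi>"
    by (simp add: inner_ell2_def cinner_add_left)
  show "inner (r *\<^sub>R \<phi>) \<psi> = r * inner \<phi> \<psi>"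
    by (simp add: inner_ell2_def scaleR_ell2_def cinner_cscale_left)
  show "0 \<le> inner \<phi> \<phi>"
    by (simp add: inner_ell2_def cinner_self infsum_nonneg)
  show "inner \<phi> \<phi> = 0 \<longleftrightarrow> \<phi> = 0"
  proof
    assume "inner \<phi> \<phi> = 0"
    then have "(\<Sum>\<^sub>\<infinity>n. (cmod (coord \<phi> n))\<^sup>2) = 0"
      by (simp add: inner_ell2_def cinner_self)
    then have "(cmod (coord \<phi> n))\<^sup>2 = 0" for n
      by (intro nonneg_infsum_le_0D[where A = UNIV and f = "\<lambda>n. (cmod (coord \<phi> n))\<^sup>2"])
        (auto simp: summable_coord)
    then show "\<phi> = 0"
      by (intro ell2_eqI) simp
  qed (simp add: inner_ell2_def cinner_self)
  show "norm \<phi> = sqrt (inner \<phi> \<phi>)"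
    by (simp add: norm_ell2_def inner_ell2_def cinner_self)
qed (auto simp: sgn_ell2_def dist_ell2_def uniformity_ell2_def open_ell2_def)
end

lift_definition ket :: "int \<Rightarrow> ell2" is "\<lambda>m n. if n = m then 1 else 0"
  subgoal for m
    using summable_on_cong_neutral[of "{m}" UNIV
      "\<lambda>n. (cmod (if n = m then 1 else 0))\<^sup>2" "\<lambda>n. (cmod (if n = m then 1 else 0))\<^sup>2"]
    by auto
  done

section \<open>Operators\<close>

definition bounded_clinear :: "(ell2 \<Rightarrow> ell2) \<Rightarrow> bool" where
  "bounded_clinear A \<longleftrightarrow>
     bounded_linear A \<and> (\<forall>c \<psi>. A (cscale c \<psi>) = cscale c (A \<psi>))"

definition selfadjoint :: "(ell2 \<Rightarrow> ell2) \<Rightarrow> bool" where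
  "selfadjoint A \<longleftrightarrow>
     bounded_clinear A \<and> (\<forall>\<phi> \<psi>. cinner \<phi> (A \<psi>) = cinner (A \<phi>) \<psi>)"

definition unitary :: "(ell2 \<Rightarrow> ell2) \<Rightarrow> bool" where
  "unitary A \<longleftrightarrow>
     bounded_clinear A \<and> bij A \<and> (\<forall>\<phi> \<psi>. cinner (A \<phi>) (A \<psi>) = cinner \<phi> \<psi>)"

definition unitary_group :: "(real \<Rightarrow> ell2 \<Rightarrow> ell2) \<Rightarrow> bool" where
  "unitary_group U \<longleftrightarrow>
     (\<forall>t. unitary (U t)) \<and>
     U 0 = id \<and> (\<forall>s t. U (s + t) = U s \<circ> U t) \<and>
     (\<forall>\<psi>. continuous_on UNIV (\<lambda>t. U t \<psi>))"

text \<open>The exponential series, with respect to the operator norm.\<close>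

definition exp_term :: "('a::real_normed_vector \<Rightarrow>\<^sub>L 'a) \<Rightarrow> nat \<Rightarrow> 'a \<Rightarrow>\<^sub>L 'a" where
  "exp_term A n = (((\<lambda>B. A o\<^sub>L B) ^^ n) id_blinfun) /\<^sub>R fact n"

definition op_exp :: "('a::real_normed_vector \<Rightarrow>\<^sub>L 'a) \<Rightarrow> 'a \<Rightarrow>\<^sub>L 'a" where
  "op_exp A = (\<Sum>n. exp_term A n)"

section \<open>The Fourier transform\<close>

text \<open>The interval \<open>(-\<pi>, \<pi>]\<close> with the measure \<open>dk / 2\<pi>\<close>. Functions on it are represented by
  functions on the real line whose values outside the interval are irrelevant.\<close>

definition circle :: "real measure" where
  "circle = uniform_measure lborel {-pi<..pi}"

definition L2_circle :: "(real \<Rightarrow> complex) set" where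
  "L2_circle = {f \<in> borel_measurable circle. integrable circle (\<lambda>k. (cmod (f k))\<^sup>2)}"

definition L2_circle_norm :: "(real \<Rightarrow> complex) \<Rightarrow> real" where
  "L2_circle_norm f = sqrt (\<integral>k. (cmod (f k))\<^sup>2 \<partial>circle)"

definition fourier_sum :: "(int \<Rightarrow> complex) \<Rightarrow> int set \<Rightarrow> real \<Rightarrow> complex" where
  "fourier_sum \<psi> F k = (\<Sum>n\<in>F. \<psi> n * exp (- (\<i> * of_real k * of_int n)))"

text \<open>A representative, unique up to null sets, of the sum of the Fourier series in the
  \<open>L\<^sup>2\<close> sense. Existence is shown in \<open>fourier_L2\<close> and \<open>fourier_limit\<close> below.\<close>

definition fourier :: "ell2 \<Rightarrow> real \<Rightarrow> complex" where
  "fourier \<psi> = (SOME f. f \<in> L2_circle \<and>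
     ((\<lambda>F. L2_circle_norm (\<lambda>k. f k - fourier_sum (coord \<psi>) F k)) \<longlongrightarrow> 0)
       (finite_subsets_at_top UNIV))"

lemma circle_eq_density:
  "circle = density lborel (\<lambda>k. ennreal (indicator {-pi<..pi} k / (2 * pi)))"
  unfolding circle_def uniform_measure_def
proof (rule density_cong)
  show "AE k in lborel. indicator {-pi<..pi} k / emeasure lborel {-pi<..pi}
          = ennreal (indicator {-pi<..pi} k / (2 * pi))"
    by (intro AE_I2) (auto simp: indicator_def divide_ennreal[symmetric])
qed auto

lemma sets_circle [measurable_cong, simp]: "sets circle = sets borel"
  by (simp add: circle_def)

lemma space_circle [simp]: "space circle = UNIV"
  by (simp add: circle_def)

lemma emeasure_circle: "emeasure circle UNIV = 1"
  unfolding circle_def by (subst emeasure_uniform_measure) auto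

interpretation circle: finite_measure circle
  by standard (simp add: emeasure_circle)

lemma integral_circle:
  assumes [measurable]: "f \<in> borel_measurable borel"
  shows "(\<integral>k. f k \<partial>circle)
    = (1 / (2 * pi)) *\<^sub>R (\<integral>k. indicator {-pi..pi} k *\<^sub>R (f k :: complex) \<partial>lborel)"
proof -
  have "(\<integral>k. f k \<partial>circle) = (\<integral>k. (indicator {-pi<..pi} k / (2 * pi)) *\<^sub>R f k \<partial>lborel)"
    unfolding circle_eq_density by (rule integral_density) auto
  also have "\<dots> = (\<integral>k. (1 / (2 * pi)) *\<^sub>R (indicator {-pi..pi} k *\<^sub>R f k) \<partial>lborel)"
  proof (rule integral_cong_AE)
    have "AE k in lborel. k \<noteq> -pi"
      by (rule AE_lborel_singleton)
    then show "AE k in lborel. (indicator {-pi<..pi} k / (2 * pi)) *\<^sub>R f k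
        = (1 / (2 * pi)) *\<^sub>R (indicator {-pi..pi} k *\<^sub>R f k)"
      by eventually_elim (auto simp: indicator_def)
  qed auto
  finally show ?thesis
    by (simp only: integral_scaleR_right)
qed

lemma integral_circle_exp:
  "(\<integral>k. exp (\<i> * of_real k * of_int n) \<partial>circle) = (if n = 0 then 1 else 0)"
proof (cases "n = 0")
  case True
  then show ?thesis by (simp add: measure_def emeasure_circle)
next
  case False
  let ?F = "\<lambda>k::real. exp (\<i> * of_real k * of_int n) / (\<i> * of_int n)"
  have "(\<integral>k. indicator {-pi..pi} k *\<^sub>R exp (\<i> * of_real k * of_int n) \<partial>lborel) = ?F pi - ?F (-pi)"
  proof (rule integral_FTC_Icc)
    show "(?F has_vector_derivative exp (\<i> * of_real k * of_int n)) (at k within {-pi..pi})" for k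
      using False by (auto intro!: derivative_eq_intros has_vector_derivative_real_field)
    show "continuous_on {-pi..pi} (\<lambda>k. exp (\<i> * of_real k * of_int n))"
      by (intro continuous_intros)
  qed simp
  also have "exp (\<i> * of_real (-pi) * of_int n) = exp (\<i> * of_real pi * of_int n)"
    unfolding exp_eq by (intro exI[of _ "-n"]) (simp add: algebra_simps)
  then have "?F pi - ?F (-pi) = 0"
    by simp
  finally show ?thesis
    using False by (subst integral_circle) auto
qed

lemma fourier_sum_measurable [measurable]: "fourier_sum \<psi> F \<in> borel_measurable borel"
  unfolding fourier_sum_def by (intro borel_measurable_continuous_onI continuous_intros)

lemma fourier_sum_bound: "cmod (fourier_sum \<psi> F k) \<le> (\<Sum>n\<in>F. cmod (\<psi> n))"
  unfolding fourier_sum_def by (rule sum_norm_le) (simp add: norm_mult)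

lemma fourier_sum_integrable: "integrable circle (\<lambda>k. (cmod (fourier_sum \<psi> F k))\<^sup>2)"
proof (rule circle.integrable_const_bound)
  show "AE k in circle. norm ((cmod (fourier_sum \<psi> F k))\<^sup>2) \<le> (\<Sum>n\<in>F. cmod (\<psi> n))\<^sup>2"
    by (intro AE_I2) (simp add: power_mono fourier_sum_bound)
qed measurable

lemma fourier_sum_norm:
  "(\<integral>k. (cmod (fourier_sum \<psi> F k))\<^sup>2 \<partial>circle) = (\<Sum>n\<in>F. (cmod (\<psi> n))\<^sup>2)"
proof (cases "finite F")
  case True
  have int: "integrable circle (\<lambda>k. exp (\<i> * of_real k * of_int n))" for n
    by (rule circle.integrable_const_bound[where B = 1]) auto
  have eq: "complex_of_real ((cmod (fourier_sum \<psi> F k))\<^sup>2) =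
      (\<Sum>n\<in>F. \<Sum>m\<in>F. \<psi> n * cnj (\<psi> m) * exp (\<i> * of_real k * of_int (m - n)))" for k
  proof -
    have "complex_of_real ((cmod (fourier_sum \<psi> F k))\<^sup>2) =
        (\<Sum>n\<in>F. \<Sum>m\<in>F. (\<psi> n * exp (- (\<i> * of_real k * of_int n))) *
          cnj (\<psi> m * exp (- (\<i> * of_real k * of_int m))))"
      unfolding complex_norm_square fourier_sum_def by (simp add: sum_product)
    also have "\<dots> = (\<Sum>n\<in>F. \<Sum>m\<in>F. \<psi> n * cnj (\<psi> m) * exp (\<i> * of_real k * of_int (m - n)))"
      by (intro sum.cong refl) (simp add: exp_cnj exp_diff exp_minus field_simps)
    finally show ?thesis .
  qed
  have "complex_of_real (\<integral>k. (cmod (fourier_sum \<psi> F k))\<^sup>2 \<partial>circle)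
      = (\<integral>k. complex_of_real ((cmod (fourier_sum \<psi> F k))\<^sup>2) \<partial>circle)"
    by (rule integral_complex_of_real[symmetric])
  also have "\<dots> = (\<Sum>n\<in>F. \<Sum>m\<in>F. \<psi> n * cnj (\<psi> m) * (if m - n = 0 then 1 else 0))"
    unfolding eq
    by (subst Bochner_Integration.integral_sum,
        intro Bochner_Integration.integrable_sum integrable_mult_right int,
        intro sum.cong refl,
        subst Bochner_Integration.integral_sum,
        intro integrable_mult_right int,
        intro sum.cong refl,
        simp only: integral_mult_right_zero integral_circle_exp)
  also have "\<dots> = (\<Sum>n\<in>F. \<Sum>m\<in>F. if m = n then \<psi> n * cnj (\<psi> n) else 0)"
    by (intro sum.cong refl) auto
  also have "\<dots> = complex_of_real (\<Sum>n\<in>F. (cmod (\<psi> n))\<^sup>2)"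
    using True by (simp add: complex_norm_square del: of_real_power)
  finally show ?thesis
    by (simp only: of_real_eq_iff)
qed (simp add: fourier_sum_def)

lemma fourier_sum_diff:
  assumes "finite A" "finite B"
  shows "fourier_sum \<psi> A k - fourier_sum \<psi> B k
    = fourier_sum (\<lambda>n. if n \<in> A then \<psi> n else - \<psi> n) ((A - B) \<union> (B - A)) k"
proof -
  let ?t = "\<lambda>n. \<psi> n * exp (- (\<i> * of_real k * of_int n))"
  have "sum ?t A = sum ?t (A \<inter> B) + sum ?t (A - B)" "sum ?t B = sum ?t (A \<inter> B) + sum ?t (B - A)"
    using assms sum.Int_Diff[of A ?t B] sum.Int_Diff[of B ?t A] by (simp_all add: Int_commute)
  then have "fourier_sum \<psi> A k - fourier_sum \<psi> B k = sum ?t (A - B) + (\<Sum>n\<in>B - A. - ?t n)"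
    by (simp add: fourier_sum_def sum_negf)
  also have "\<dots> = fourier_sum (\<lambda>n. if n \<in> A then \<psi> n else - \<psi> n) ((A - B) \<union> (B - A)) k"
    unfolding fourier_sum_def using assms by (subst sum.union_disjoint) (auto intro!: sum.cong arg_cong2[of _ _ _ _ "(+)"])
  finally show ?thesis .
qed

lemma nn_fourier_sum_diff:
  assumes "finite A" "finite B"
  shows "(\<integral>\<^sup>+k. ennreal ((cmod (fourier_sum \<psi> A k - fourier_sum \<psi> B k))\<^sup>2) \<partial>circle)
    = ennreal (\<Sum>n\<in>(A - B) \<union> (B - A). (cmod (\<psi> n))\<^sup>2)"
  unfolding fourier_sum_diff[OF assms]
  by (subst nn_integral_eq_integral[OF fourier_sum_integrable])
    (auto simp: fourier_sum_norm intro!: arg_cong[where f = ennreal] sum.cong)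

lemma square_sum_tail:
  assumes "e > 0"
  obtains G where "finite G"
    "\<And>F. finite F \<Longrightarrow> F \<inter> G = {} \<Longrightarrow> (\<Sum>n\<in>F. (cmod (coord \<psi> n))\<^sup>2) \<le> e"
proof -
  let ?g = "\<lambda>n. (cmod (coord \<psi> n))\<^sup>2"
  obtain G where G: "finite G" "dist (sum ?g G) (infsum ?g UNIV) \<le> e"
    using infsum_finite_approximation[OF summable_coord assms] by blast
  have "sum ?g F \<le> e" if F: "finite F" "F \<inter> G = {}" for F
  proof -
    have "sum ?g F + sum ?g G = sum ?g (F \<union> G)"
      using F G by (simp add: sum.union_disjoint)
    also have "\<dots> \<le> infsum ?g UNIV"
      using F G by (intro finite_sum_le_infsum summable_coord) auto
    finally show ?thesis
      using G(2) by (simp add: dist_real_def)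
  qed
  with G(1) that show thesis by blast
qed

lemma fourier_exists:
  "\<exists>f. f \<in> L2_circle \<and>
     ((\<lambda>F. L2_circle_norm (\<lambda>k. f k - fourier_sum (coord \<psi>) F k)) \<longlongrightarrow> 0)
       (finite_subsets_at_top UNIV)"
proof -
  let ?g = "\<lambda>n. (cmod (coord \<psi> n))\<^sup>2"
  have "\<exists>G. finite G \<and> (\<forall>F. finite F \<longrightarrow> F \<inter> G = {} \<longrightarrow> sum ?g F \<le> (1/4)^j)" for j :: nat
    using square_sum_tail[of "(1/4)^j" \<psi>] by (metis zero_less_divide_1_iff zero_less_numeral zero_less_power)
  then obtain G0 where G0: "\<And>j. finite (G0 j)"
    "\<And>j F. finite F \<Longrightarrow> F \<inter> G0 j = {} \<Longrightarrow> sum ?g F \<le> (1/4)^j" for j :: nat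
    by metis
  define G where "G j = (\<Union>i\<le>j. G0 i)" for j
  have finG: "finite (G j)" for j
    by (simp add: G_def G0)
  have incG: "G i \<subseteq> G j" if "i \<le> j" for i j
    using that by (force simp: G_def)
  have tailG: "sum ?g F \<le> (1/4)^j" if "finite F" "F \<inter> G j = {}" for F j
    by (rule G0(2)) (use that in \<open>auto simp: G_def\<close>)
  define s where "s j = fourier_sum (coord \<psi>) (G j)" for j
  have [measurable]: "s j \<in> borel_measurable borel" for j
    by (simp add: s_def fourier_sum_measurable)
  have step: "(\<integral>\<^sup>+k. ennreal ((cmod (s j k - fourier_sum (coord \<psi>) F k))\<^sup>2) \<partial>circle)
      \<le> ennreal ((1/4)^i)" if "finite F" "G i \<subseteq> F" "i \<le> j" for i j F
    unfolding s_def nn_fourier_sum_diff[OF finG that(1)]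
    by (intro ennreal_leI tailG) (use that finG incG[OF that(3)] in auto)
  have step_Suc: "(\<integral>\<^sup>+k. ennreal (2^j * (cmod (s (Suc j) k - s j k))\<^sup>2) \<partial>circle)
      \<le> ennreal ((1/2)^j)" for j
  proof -
    have "(\<integral>\<^sup>+k. ennreal (2^j * (cmod (s (Suc j) k - s j k))\<^sup>2) \<partial>circle)
      = ennreal (2^j) * (\<integral>\<^sup>+k. ennreal ((cmod (s (Suc j) k - s j k))\<^sup>2) \<partial>circle)"
      by (subst nn_integral_cmult[symmetric]) (auto simp: ennreal_mult)
    also have "\<dots> \<le> ennreal (2^j) * ennreal ((1/4)^j)"
      using step[of "G j" j "Suc j"] by (intro mult_left_mono) (auto simp: finG s_def)
    also have "\<dots> = ennreal ((1/2)^j)"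
      by (simp add: ennreal_mult[symmetric] power_mult_distrib[symmetric])
    finally show ?thesis .
  qed
  have "(\<integral>\<^sup>+k. (\<Sum>j. ennreal (2^j * (cmod (s (Suc j) k - s j k))\<^sup>2)) \<partial>circle)
      \<le> (\<Sum>j. ennreal ((1/2)^j))"
    by (subst nn_integral_suminf) (auto intro!: suminf_le step_Suc)
  also have "\<dots> = ennreal (\<Sum>j. (1/2)^j)"
    by (rule suminf_ennreal2) (auto intro!: summable_geometric)
  finally have "AE k in circle. (\<Sum>j. ennreal (2^j * (cmod (s (Suc j) k - s j k))\<^sup>2)) \<noteq> \<infinity>"
    by (intro nn_integral_PInf_AE) (auto simp: top_unique)
  then have conv: "AE k in circle. convergent (\<lambda>j. s j k)"
  proof eventually_elim
    case (elim k)
    have "summable (\<lambda>j. 2^j * (cmod (s (Suc j) k - s j k))\<^sup>2)"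
      using elim by (intro summable_suminf_not_top) auto
    then have "summable (\<lambda>j. (1/2)^j + 2^j * (cmod (s (Suc j) k - s j k))\<^sup>2)"
      by (intro summable_add summable_geometric) auto
    then have "summable (\<lambda>j. s (Suc j) k - s j k)"
    proof (rule summable_comparison_test')
      fix j :: nat
      let ?d = "cmod (s (Suc j) k - s j k)"
      have "?d * 2^j \<le> 1 + (?d * 2^j)\<^sup>2"
        using sum_squares_bound[of 1 "?d * 2^j"] by (simp add: power2_eq_square)
          (smt (verit) mult_nonneg_nonneg norm_ge_zero zero_le_power)
      then have "(?d * 2^j) * (1/2)^j \<le> (1 + (?d * 2^j)\<^sup>2) * (1/2)^j"
        by (intro mult_right_mono) auto
      then show "norm (s (Suc j) k - s j k) \<le> (1/2)^j + 2^j * ?d\<^sup>2"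
        by (simp add: power_one_over power_mult_distrib field_simps power2_eq_square)
    qed
    then have "convergent (\<lambda>N. (\<Sum>j<N. s (Suc j) k - s j k) + s 0 k)"
      by (intro convergent_add convergent_const) (simp add: summable_iff_convergent)
    then show ?case
      by (simp add: sum_lessThan_telescope[of "\<lambda>j. s j k"])
  qed
  define f where "f k = lim (\<lambda>j. s j k)" for k
  have f_meas [measurable]: "f \<in> borel_measurable borel"
    unfolding f_def by measurable
  have bound: "(\<integral>\<^sup>+k. ennreal ((cmod (f k - fourier_sum (coord \<psi>) F k))\<^sup>2) \<partial>circle)
      \<le> ennreal ((1/4)^i)" if F: "finite F" "G i \<subseteq> F" for i F
  proof -
    have "(\<integral>\<^sup>+k. ennreal ((cmod (f k - fourier_sum (coord \<psi>) F k))\<^sup>2) \<partial>circle)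
      = (\<integral>\<^sup>+k. liminf (\<lambda>j. ennreal ((cmod (s j k - fourier_sum (coord \<psi>) F k))\<^sup>2)) \<partial>circle)"
      using conv
    proof (intro nn_integral_cong_AE, eventually_elim)
      case (elim k)
      then have "(\<lambda>j. s j k) \<longlonglongrightarrow> f k"
        by (simp add: f_def convergent_LIMSEQ_iff)
      then have "(\<lambda>j. ennreal ((cmod (s j k - fourier_sum (coord \<psi>) F k))\<^sup>2))
          \<longlonglongrightarrow> ennreal ((cmod (f k - fourier_sum (coord \<psi>) F k))\<^sup>2)"
        by (intro tendsto_intros)
      then show ?case
        by (rule lim_imp_Liminf[OF sequentially_bot, symmetric])
    qed
    also have "\<dots> \<le> liminf (\<lambda>j. \<integral>\<^sup>+k. ennreal ((cmod (s j k - fourier_sum (coord \<psi>) F k))\<^sup>2) \<partial>circle)"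
      by (rule nn_integral_liminf) measurable
    also have "\<dots> \<le> ennreal ((1/4)^i)"
    proof (rule Liminf_le)
      show "\<forall>\<^sub>F j in sequentially.
          (\<integral>\<^sup>+k. ennreal ((cmod (s j k - fourier_sum (coord \<psi>) F k))\<^sup>2) \<partial>circle) \<le> ennreal ((1/4)^i)"
        using eventually_ge_at_top[of i] by eventually_elim (rule step[OF F])
    qed simp
    finally show ?thesis .
  qed
  have int: "integrable circle (\<lambda>k. (cmod (f k - fourier_sum (coord \<psi>) F k))\<^sup>2)"
    if "finite F" "G i \<subseteq> F" for i F
    by (rule integrableI_bounded) (use bound[OF that] in \<open>auto simp: top_unique less_top[symmetric]\<close>)
  have "f \<in> L2_circle"
    unfolding L2_circle_def
  proof (intro CollectI conjI)
    show "f \<in> borel_measurable circle" by measurable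
    show "integrable circle (\<lambda>k. (cmod (f k))\<^sup>2)"
    proof (rule Bochner_Integration.integrable_bound)
      show "integrable circle (\<lambda>k. 2 * (cmod (f k - s 0 k))\<^sup>2 + 2 * (cmod (s 0 k))\<^sup>2)"
        unfolding s_def
        by (intro Bochner_Integration.integrable_add integrable_mult_right int[OF finG order_refl]
          fourier_sum_integrable)
      show "AE k in circle. norm ((cmod (f k))\<^sup>2)
          \<le> norm (2 * (cmod (f k - s 0 k))\<^sup>2 + 2 * (cmod (s 0 k))\<^sup>2)"
      proof (intro AE_I2)
        fix k
        have "(cmod (f k))\<^sup>2 \<le> (cmod (f k - s 0 k) + cmod (s 0 k))\<^sup>2"
          using norm_triangle_ineq[of "f k - s 0 k" "s 0 k"] by (intro power_mono) auto
        also have "\<dots> \<le> 2 * (cmod (f k - s 0 k))\<^sup>2 + 2 * (cmod (s 0 k))\<^sup>2"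
          using sum_squares_bound[of "cmod (f k - s 0 k)" "cmod (s 0 k)"] by (simp add: power2_sum)
        finally show "norm ((cmod (f k))\<^sup>2)
            \<le> norm (2 * (cmod (f k - s 0 k))\<^sup>2 + 2 * (cmod (s 0 k))\<^sup>2)"
          by simp
      qed
    qed measurable
  qed
  moreover have "((\<lambda>F. L2_circle_norm (\<lambda>k. f k - fourier_sum (coord \<psi>) F k)) \<longlongrightarrow> 0)
      (finite_subsets_at_top UNIV)"
  proof (rule tendstoI)
    fix e :: real
    assume "e > 0"
    then obtain i where i: "(1/2)^i < e"
      using real_arch_pow_inv[of e "1/2"] by auto
    have "\<forall>\<^sub>F F in finite_subsets_at_top UNIV. finite F \<and> G i \<subseteq> F"
      unfolding eventually_finite_subsets_at_top using finG by (intro exI[of _ "G i"]) auto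
    then show "\<forall>\<^sub>F F in finite_subsets_at_top UNIV.
        dist (L2_circle_norm (\<lambda>k. f k - fourier_sum (coord \<psi>) F k)) 0 < e"
    proof eventually_elim
      case (elim F)
      have "ennreal (\<integral>k. (cmod (f k - fourier_sum (coord \<psi>) F k))\<^sup>2 \<partial>circle) \<le> ennreal ((1/4)^i)"
        using bound[of F i] elim
        by (subst nn_integral_eq_integral[symmetric]) (auto intro: int)
      then have "(\<integral>k. (cmod (f k - fourier_sum (coord \<psi>) F k))\<^sup>2 \<partial>circle) \<le> (1/4)^i"
        by simp
      also have "(1/4)^i = ((1/2::real)^i)\<^sup>2"
        by (simp add: power2_eq_square power_mult_distrib[symmetric])
      finally have "L2_circle_norm (\<lambda>k. f k - fourier_sum (coord \<psi>) F k) \<le> (1/2)^i"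
        unfolding L2_circle_norm_def by (intro real_le_lsqrt) auto
      with i show ?case
        by (simp add: L2_circle_norm_def)
    qed
  qed
  ultimately show ?thesis by blast
qed

lemma
  shows fourier_L2: "fourier \<psi> \<in> L2_circle"
    and fourier_limit:
      "((\<lambda>F. L2_circle_norm (\<lambda>k. fourier \<psi> k - fourier_sum (coord \<psi>) F k)) \<longlongrightarrow> 0)
         (finite_subsets_at_top UNIV)"
  using someI_ex[OF fourier_exists[of \<psi>]] by (simp_all add: fourier_def)

section \<open>The Hamiltonian\<close>

definition hop_seq :: "real \<Rightarrow> (int \<Rightarrow> complex) \<Rightarrow> (int \<Rightarrow> complex) \<Rightarrow> int \<Rightarrow> complex" where
  "hop_seq h K \<psi> n = of_real h * (\<Sum>\<^sub>\<infinity>\<alpha>. K \<alpha> * \<psi> (n - \<alpha>))"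

text \<open>\<open>Abs_ell2\<close> is meaningful only on square-summable sequences, so that
  \<open>coord (hamiltonian h K \<psi>) = hop_seq h K (coord \<psi>)\<close> is a property to be proved.\<close>

definition hamiltonian :: "real \<Rightarrow> (int \<Rightarrow> complex) \<Rightarrow> ell2 \<Rightarrow> ell2" where
  "hamiltonian h K \<psi> = Abs_ell2 (hop_seq h K (coord \<psi>))"

definition dispersion :: "real \<Rightarrow> (int \<Rightarrow> complex) \<Rightarrow> real \<Rightarrow> complex" where
  "dispersion h K k = of_real h * (\<Sum>\<^sub>\<infinity>\<alpha>. K \<alpha> * exp (- (\<i> * of_real k * of_int \<alpha>)))"

text \<open>The operator \<open>-(i/h) H t\<close>. \<open>Blinfun\<close> is meaningful only once \<open>H\<close> is known to be bounded.\<close>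

definition generator :: "real \<Rightarrow> (int \<Rightarrow> complex) \<Rightarrow> real \<Rightarrow> ell2 \<Rightarrow>\<^sub>L ell2" where
  "generator h K t = Blinfun (\<lambda>\<psi>. cscale (- (\<i> / of_real h) * of_real t) (hamiltonian h K \<psi>))"

definition evolution :: "real \<Rightarrow> (int \<Rightarrow> complex) \<Rightarrow> real \<Rightarrow> ell2 \<Rightarrow> ell2" where
  "evolution h K t = blinfun_apply (op_exp (generator h K t))"

definition prop_kernel :: "real \<Rightarrow> (int \<Rightarrow> complex) \<Rightarrow> real \<Rightarrow> int \<Rightarrow> int \<Rightarrow> complex" where
  "prop_kernel h K t n m = cinner (ket n) (evolution h K t (ket m))"

end

theory Submission
  imports Defs
begin

text \<open>
  The discrete Fourier transform is an isometry (Parseval), and an operator is determined by the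
  function of \<open>k\<close> by which it multiplies Fourier transforms. Such multiplication operators
  are closed under sums, composition and limits that are strong for the operators and uniform for
  the functions. Translation by \<open>\<alpha>\<close> multiplies by \<open>e\<^sup>-\<^sup>i\<^sup>k\<^sup>\<alpha>\<close>, so \<open>H\<close>, an absolutely
  convergent sum of translations, multiplies by \<open>E\<close>, and the exponential series of
  \<open>-iHt/h\<close> multiplies by the exponential of \<open>-iEt/h\<close>. Boundedness, self-adjointness, the
  group law, unitarity and strong continuity are then read off from the multiplying functions.
\<close>

section \<open>Completeness of the sequence space\<close>

lemma norm_ell2_power2: "(norm \<psi>)\<^sup>2 = (\<Sum>\<^sub>\<infinity>n. (cmod (coord \<psi> n))\<^sup>2)"
  by (simp add: norm_ell2_def infsum_nonneg)

lemma sum_coord_le_norm: "finite F \<Longrightarrow> (\<Sum>n\<in>F. (cmod (coord \<psi> n))\<^sup>2) \<le> (norm \<psi>)\<^sup>2"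
  unfolding norm_ell2_power2 by (intro finite_sum_le_infsum summable_coord) auto

lemma norm_ell2_le:
  assumes "C \<ge> 0" "\<And>F. finite F \<Longrightarrow> (\<Sum>n\<in>F. (cmod (coord \<psi> n))\<^sup>2) \<le> C\<^sup>2"
  shows "norm \<psi> \<le> C"
  using assms by (intro power2_le_imp_le[of "norm \<psi>" C])
    (auto simp: norm_ell2_power2 intro!: infsum_le_finite_sums summable_coord)

lemma norm_coord_le: "cmod (coord \<psi> n) \<le> norm \<psi>"
  using sum_coord_le_norm[of "{n}" \<psi>] by (simp add: power2_le_iff_abs_le)

lemma bounded_linear_coord: "bounded_linear (\<lambda>\<psi>. coord \<psi> n)"
  by (rule bounded_linear_intro[where K = 1]) (auto simp: norm_coord_le)

lemma norm_cscale: "norm (cscale c \<psi>) = cmod c * norm \<psi>"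
  by (simp add: norm_ell2_def norm_mult power_mult_distrib infsum_cmult_right' real_sqrt_mult)

lemma bounded_linear_cscale: "bounded_linear (cscale c)"
  by (rule bounded_linear_intro[where K = "cmod c"])
    (auto simp: norm_cscale algebra_simps intro!: ell2_eqI)

text \<open>Coordinates of a Cauchy sequence converge, and estimates on finite partial sums survive
  the limit, so the coordinatewise limit is square-summable and is also the limit in norm.
  Completeness is what makes the exponential series and the absolutely convergent sum of
  translations converge.\<close>

instance ell2 :: banach
proof
  fix X :: "nat \<Rightarrow> ell2"
  assume X: "Cauchy X"
  have "convergent (\<lambda>j. coord (X j) n)" for n
    by (intro Cauchy_convergent bounded_linear.Cauchy[OF bounded_linear_coord] X)
  then obtain a where a: "\<And>n. (\<lambda>j. coord (X j) n) \<longlonglongrightarrow> a n"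
    unfolding convergent_def by metis
  \<comment> \<open>\<open>N\<close> depends on \<open>e\<close> alone and serves all finite
    \<open>F\<close>. Over a finite set the limit in \<open>j\<close> can be taken term by term in
    the bound given by the Cauchy property.\<close>
  have tail: "\<exists>N. \<forall>i\<ge>N. \<forall>F. finite F \<longrightarrow> (\<Sum>n\<in>F. (cmod (coord (X i) n - a n))\<^sup>2) \<le> e\<^sup>2"
    if "e > 0" for e
  proof -
    obtain N where N: "\<And>i j. i \<ge> N \<Longrightarrow> j \<ge> N \<Longrightarrow> norm (X i - X j) < e"
      using CauchyD[OF X \<open>e > 0\<close>] by blast
    have "(\<Sum>n\<in>F. (cmod (coord (X i) n - a n))\<^sup>2) \<le> e\<^sup>2" if "i \<ge> N" "finite F" for i F
    proof (rule tendsto_upperbound)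
      show "(\<lambda>j. \<Sum>n\<in>F. (cmod (coord (X i) n - coord (X j) n))\<^sup>2)
          \<longlonglongrightarrow> (\<Sum>n\<in>F. (cmod (coord (X i) n - a n))\<^sup>2)"
        by (intro tendsto_intros a)
      show "\<forall>\<^sub>F j in sequentially. (\<Sum>n\<in>F. (cmod (coord (X i) n - coord (X j) n))\<^sup>2) \<le> e\<^sup>2"
        using eventually_ge_at_top[of N]
      proof eventually_elim
        case (elim j)
        have "(\<Sum>n\<in>F. (cmod (coord (X i - X j) n))\<^sup>2) \<le> (norm (X i - X j))\<^sup>2"
          by (rule sum_coord_le_norm) fact
        also have "\<dots> \<le> e\<^sup>2"
          using N[of i j] that elim by (intro power_mono) auto
        finally show ?case by simp
      qed
    qed simp
    then show ?thesis by blast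
  qed
  \<comment> \<open>Write \<open>a\<close> as \<open>(a - X N) + X N\<close>; the tail estimate with
    \<open>e = 1\<close> makes the first summand square-summable.\<close>
  have "(\<lambda>n. (cmod (a n))\<^sup>2) summable_on UNIV"
  proof -
    obtain N where "\<And>F. finite F \<Longrightarrow> (\<Sum>n\<in>F. (cmod (coord (X N) n - a n))\<^sup>2) \<le> 1"
      using tail[of 1] by auto
    then have "(\<lambda>n. (cmod (a n - coord (X N) n))\<^sup>2) summable_on UNIV"
      by (intro nonneg_bdd_above_summable_on bdd_aboveI[of _ 1]) (auto simp: norm_minus_commute)
    from summable_square_add[OF this summable_coord[of "X N"]] show ?thesis by simp
  qed
  then have coord_a: "coord (Abs_ell2 a) = a"
    by (intro Abs_ell2_inverse) simp
  have "X \<longlonglongrightarrow> Abs_ell2 a"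
  proof (rule LIMSEQ_I)
    fix r :: real
    assume "r > 0"
    then obtain N where "\<And>i F. i \<ge> N \<Longrightarrow> finite F \<Longrightarrow> (\<Sum>n\<in>F. (cmod (coord (X i) n - a n))\<^sup>2) \<le> (r/2)\<^sup>2"
      using tail[of "r/2"] by auto
    then have "norm (X i - Abs_ell2 a) \<le> r/2" if "i \<ge> N" for i
      using that \<open>r > 0\<close> by (intro norm_ell2_le) (auto simp: coord_a)
    then show "\<exists>N. \<forall>i\<ge>N. norm (X i - Abs_ell2 a) < r"
      using \<open>r > 0\<close> by (intro exI[of _ N]) (smt (verit) field_sum_of_halves)
  qed
  then show "convergent X"
    by (auto simp: convergent_def)
qed

section \<open>Translations of the lattice\<close>

lift_definition shift :: "int \<Rightarrow> ell2 \<Rightarrow> ell2" is "\<lambda>\<alpha> \<psi> n. \<psi> (n - \<alpha>)"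
  subgoal for \<alpha> \<psi>
    by (subst summable_on_reindex_bij_witness[of UNIV "\<lambda>n. n + \<alpha>" "\<lambda>n. n - \<alpha>" UNIV "\<lambda>n. (cmod (\<psi> n))\<^sup>2"]) auto
  done

lemma norm_shift: "norm (shift \<alpha> \<psi>) = norm \<psi>"
  unfolding norm_ell2_def
  by (subst infsum_reindex_bij_witness[of UNIV "\<lambda>n. n + \<alpha>" "\<lambda>n. n - \<alpha>" UNIV "\<lambda>n. (cmod (coord \<psi> n))\<^sup>2"])
    (auto simp: shift.rep_eq)

section \<open>Square-integrable functions on the circle\<close>

lemma circle_measurable [simp]: "borel_measurable circle = borel_measurable borel"
  by (rule measurable_cong_sets) auto

lemma L2_circleD:
  assumes "f \<in> L2_circle"
  shows "f \<in> borel_measurable borel" "integrable circle (\<lambda>k. (cmod (f k))\<^sup>2)"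
  using assms by (auto simp: L2_circle_def)

lemma L2_circle_norm_nonneg [simp]: "0 \<le> L2_circle_norm f"
  by (simp add: L2_circle_norm_def)

lemma L2_circle_norm_power2: "(L2_circle_norm f)\<^sup>2 = (\<integral>k. (cmod (f k))\<^sup>2 \<partial>circle)"
  by (simp add: L2_circle_norm_def)

lemma L2_circle_mult_bounded:
  assumes "f \<in> L2_circle" "m \<in> borel_measurable borel" "\<And>k. cmod (m k) \<le> C"
  shows "(\<lambda>k. m k * f k) \<in> L2_circle" "L2_circle_norm (\<lambda>k. m k * f k) \<le> C * L2_circle_norm f"
proof -
  note [measurable] = assms(2) L2_circleD(1)[OF assms(1)]
  have C: "C \<ge> 0"
    by (rule order_trans[OF norm_ge_zero assms(3)[of 0]])
  have le: "(cmod (m k * f k))\<^sup>2 \<le> C\<^sup>2 * (cmod (f k))\<^sup>2" for k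
    using assms(3)[of k] by (simp add: norm_mult power_mult_distrib mult_right_mono power_mono)
  have int: "integrable circle (\<lambda>k. C\<^sup>2 * (cmod (f k))\<^sup>2)"
    by (intro integrable_mult_right L2_circleD assms)
  have int': "integrable circle (\<lambda>k. (cmod (m k * f k))\<^sup>2)"
    by (rule Bochner_Integration.integrable_bound[OF int]) (use le in auto)
  then show "(\<lambda>k. m k * f k) \<in> L2_circle"
    by (simp add: L2_circle_def)
  show "L2_circle_norm (\<lambda>k. m k * f k) \<le> C * L2_circle_norm f"
  proof (rule power2_le_imp_le)
    have "(L2_circle_norm (\<lambda>k. m k * f k))\<^sup>2 \<le> (\<integral>k. C\<^sup>2 * (cmod (f k))\<^sup>2 \<partial>circle)"
      unfolding L2_circle_norm_power2 by (intro integral_mono int int' le)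
    then show "(L2_circle_norm (\<lambda>k. m k * f k))\<^sup>2 \<le> (C * L2_circle_norm f)\<^sup>2"
      by (simp add: power_mult_distrib L2_circle_norm_power2)
  qed (simp add: C)
qed

text \<open>Integrability of the product comes from \<open>2 a b \<le> a^2 + b^2\<close>. The
  inequality is transferred from integrals with values in \<open>ennreal\<close>, where it bounds
  the square of the integral, so a square root is taken at the end.\<close>

lemma L2_circle_Cauchy_Schwarz:
  assumes "f \<in> L2_circle" "g \<in> L2_circle"
  shows "integrable circle (\<lambda>k. cmod (f k) * cmod (g k))"
    and "(\<integral>k. cmod (f k) * cmod (g k) \<partial>circle) \<le> L2_circle_norm f * L2_circle_norm g"
proof -
  note [measurable] = L2_circleD(1)[OF assms(1)] L2_circleD(1)[OF assms(2)]
  have "integrable circle (\<lambda>k. (cmod (f k))\<^sup>2 + (cmod (g k))\<^sup>2)"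
    by (intro Bochner_Integration.integrable_add L2_circleD assms)
  then show int: "integrable circle (\<lambda>k. cmod (f k) * cmod (g k))"
  proof (rule Bochner_Integration.integrable_bound, measurable, intro AE_I2)
    fix k
    have "cmod (f k) * cmod (g k) \<le> 2 * cmod (f k) * cmod (g k)"
      by simp
    also have "\<dots> \<le> (cmod (f k))\<^sup>2 + (cmod (g k))\<^sup>2"
      by (rule sum_squares_bound)
    finally show "norm (cmod (f k) * cmod (g k)) \<le> norm ((cmod (f k))\<^sup>2 + (cmod (g k))\<^sup>2)"
      by simp
  qed
  have eq: "(\<integral>\<^sup>+k. (ennreal (cmod (h k)))\<^sup>2 \<partial>circle) = ennreal ((L2_circle_norm h)\<^sup>2)"
    if "h \<in> L2_circle" for h
    unfolding L2_circle_norm_power2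
    by (subst nn_integral_eq_integral[symmetric]) (auto simp: ennreal_power L2_circleD that)
  have "ennreal ((\<integral>k. cmod (f k) * cmod (g k) \<partial>circle)\<^sup>2)
      = (\<integral>\<^sup>+k. ennreal (cmod (f k)) * ennreal (cmod (g k)) \<partial>circle)\<^sup>2"
    by (simp add: ennreal_mult[symmetric] nn_integral_eq_integral[OF int] ennreal_power)
  also have "\<dots> \<le> ennreal ((L2_circle_norm f)\<^sup>2) * ennreal ((L2_circle_norm g)\<^sup>2)"
    unfolding eq[OF assms(1), symmetric] eq[OF assms(2), symmetric]
    by (intro Cauchy_Schwarz_nn_integral) auto
  finally have "(\<integral>k. cmod (f k) * cmod (g k) \<partial>circle)\<^sup>2 \<le> (L2_circle_norm f * L2_circle_norm g)\<^sup>2"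
    by (simp add: ennreal_mult[symmetric] power_mult_distrib)
  then show "(\<integral>k. cmod (f k) * cmod (g k) \<partial>circle) \<le> L2_circle_norm f * L2_circle_norm g"
    by (rule power2_le_imp_le) simp
qed

lemma L2_circle_add:
  assumes "f \<in> L2_circle" "g \<in> L2_circle"
  shows "(\<lambda>k. f k + g k) \<in> L2_circle"
    and "L2_circle_norm (\<lambda>k. f k + g k) \<le> L2_circle_norm f + L2_circle_norm g"
proof -
  note [measurable] = L2_circleD(1)[OF assms(1)] L2_circleD(1)[OF assms(2)]
  let ?b = "\<lambda>k. (cmod (f k))\<^sup>2 + (cmod (g k))\<^sup>2 + 2 * (cmod (f k) * cmod (g k))"
  note ints = L2_circleD(2)[OF assms(1)] L2_circleD(2)[OF assms(2)] L2_circle_Cauchy_Schwarz(1)[OF assms]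
  have le: "(cmod (f k + g k))\<^sup>2 \<le> ?b k" for k
    using power_mono[OF norm_triangle_ineq[of "f k" "g k"], of 2] by (simp add: power2_sum)
  have int: "integrable circle ?b"
    by (intro Bochner_Integration.integrable_add integrable_mult_right ints)
  have int': "integrable circle (\<lambda>k. (cmod (f k + g k))\<^sup>2)"
    by (rule Bochner_Integration.integrable_bound[OF int]) (use le in \<open>auto simp: abs_of_nonneg\<close>)
  then show "(\<lambda>k. f k + g k) \<in> L2_circle"
    by (simp add: L2_circle_def)
  show "L2_circle_norm (\<lambda>k. f k + g k) \<le> L2_circle_norm f + L2_circle_norm g"
  proof (rule power2_le_imp_le)
    have "(L2_circle_norm (\<lambda>k. f k + g k))\<^sup>2 \<le> (\<integral>k. ?b k \<partial>circle)"
      unfolding L2_circle_norm_power2 by (intro integral_mono int int' le)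
    also have "\<dots> = (L2_circle_norm f)\<^sup>2 + (L2_circle_norm g)\<^sup>2
        + 2 * (\<integral>k. cmod (f k) * cmod (g k) \<partial>circle)"
      using ints by (simp add: L2_circle_norm_power2)
    also have "\<dots> \<le> (L2_circle_norm f + L2_circle_norm g)\<^sup>2"
      using L2_circle_Cauchy_Schwarz(2)[OF assms] by (simp add: power2_sum)
    finally show "(L2_circle_norm (\<lambda>k. f k + g k))\<^sup>2 \<le> (L2_circle_norm f + L2_circle_norm g)\<^sup>2" .
  qed simp
qed

lemma L2_circle_cmult:
  assumes "f \<in> L2_circle"
  shows "(\<lambda>k. c * f k) \<in> L2_circle" "L2_circle_norm (\<lambda>k. c * f k) \<le> cmod c * L2_circle_norm f"
  using L2_circle_mult_bounded[OF assms, of "\<lambda>_. c" "cmod c"] by auto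

lemma L2_circle_diff:
  assumes "f \<in> L2_circle" "g \<in> L2_circle"
  shows "(\<lambda>k. f k - g k) \<in> L2_circle"
  using L2_circle_add(1)[OF assms(1) L2_circle_cmult(1)[OF assms(2), of "-1"]] by simp

lemma L2_circle_norm_minus_commute:
  "L2_circle_norm (\<lambda>k. f k - g k) = L2_circle_norm (\<lambda>k. g k - f k)"
  by (simp add: L2_circle_norm_def norm_minus_commute)

text \<open>Both differences on the right subtract the same \<open>s\<close>: this form compares two
  candidates for a limit through a common approximation.\<close>

lemma L2_circle_norm_triangle:
  assumes "f \<in> L2_circle" "g \<in> L2_circle" "s \<in> L2_circle"
  shows "L2_circle_norm (\<lambda>k. f k - g k)
    \<le> L2_circle_norm (\<lambda>k. f k - s k) + L2_circle_norm (\<lambda>k. g k - s k)"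
  using L2_circle_add(2)[OF L2_circle_diff[OF assms(1,3)] L2_circle_diff[OF assms(3,2)]]
  by (simp add: L2_circle_norm_minus_commute[of s g])

lemma L2_circle_norm_eq_0:
  assumes "f \<in> L2_circle" "L2_circle_norm f \<le> 0"
  shows "AE k in circle. f k = 0"
proof -
  have "(\<integral>k. (cmod (f k))\<^sup>2 \<partial>circle) = 0"
    using assms(2) L2_circle_norm_power2[of f] L2_circle_norm_nonneg[of f] by simp
  then show ?thesis
    using L2_circleD[OF assms(1)] by (simp add: integral_nonneg_eq_0_iff_AE)
qed

lemma L2_circle_norm_cong_AE:
  assumes "f \<in> borel_measurable borel" "g \<in> borel_measurable borel" "AE k in circle. f k = g k"
  shows "L2_circle_norm f = L2_circle_norm g"
  unfolding L2_circle_norm_def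
  using assms by (intro arg_cong[where f = sqrt] integral_cong_AE) auto

lemma fourier_sum_L2: "fourier_sum \<psi> F \<in> L2_circle"
  by (simp add: L2_circle_def fourier_sum_integrable fourier_sum_measurable)

section \<open>The Fourier transform\<close>

text \<open>Limits in the \<open>L2\<close> norm are unique up to null sets. Since
  \<open>fourier\<close> is an arbitrary choice of representative, its values are identified by
  exhibiting another limit of the same partial sums.\<close>

lemma AE_fourier_eqI:
  assumes "g \<in> L2_circle"
    and "((\<lambda>F. L2_circle_norm (\<lambda>k. g k - fourier_sum (coord \<psi>) F k)) \<longlongrightarrow> 0)
           (finite_subsets_at_top UNIV)"
  shows "AE k in circle. fourier \<psi> k = g k"
proof -
  let ?S = "\<lambda>F. fourier_sum (coord \<psi>) F"
  have "((\<lambda>F. L2_circle_norm (\<lambda>k. fourier \<psi> k - ?S F k) + L2_circle_norm (\<lambda>k. g k - ?S F k))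
      \<longlongrightarrow> 0 + 0) (finite_subsets_at_top UNIV)"
    by (intro tendsto_add fourier_limit assms)
  then have "L2_circle_norm (\<lambda>k. fourier \<psi> k - g k) \<le> 0 + 0"
    by (rule tendsto_lowerbound)
      (intro always_eventually allI L2_circle_norm_triangle fourier_L2 assms fourier_sum_L2, simp)
  then have "AE k in circle. fourier \<psi> k - g k = 0"
    by (intro L2_circle_norm_eq_0 L2_circle_diff fourier_L2 assms) simp
  then show ?thesis by simp
qed

section \<open>Transforms of sums, multiples, translates and basis vectors\<close>

lemma fourier_add: "AE k in circle. fourier (\<phi> + \<psi>) k = fourier \<phi> k + fourier \<psi> k"
proof (rule AE_fourier_eqI)
  let ?d = "\<lambda>\<psi> F k. fourier \<psi> k - fourier_sum (coord \<psi>) F k"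
  have lim: "((\<lambda>F. L2_circle_norm (?d \<phi> F) + L2_circle_norm (?d \<psi> F)) \<longlongrightarrow> 0)
      (finite_subsets_at_top UNIV)"
    by (intro tendsto_add_zero fourier_limit)
  \<comment> \<open>For each \<open>F\<close> the error of the sum is exactly the sum of the two
    errors, because partial sums are additive in the sequence.\<close>
  have "(\<lambda>k. fourier \<phi> k + fourier \<psi> k - fourier_sum (coord (\<phi> + \<psi>)) F k)
      = (\<lambda>k. ?d \<phi> F k + ?d \<psi> F k)" for F
    by (auto simp: fourier_sum_def algebra_simps sum.distrib)
  then have le: "L2_circle_norm (\<lambda>k. fourier \<phi> k + fourier \<psi> k - fourier_sum (coord (\<phi> + \<psi>)) F k)
      \<le> L2_circle_norm (?d \<phi> F) + L2_circle_norm (?d \<psi> F)" for F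
    using L2_circle_add(2)[OF L2_circle_diff[OF fourier_L2 fourier_sum_L2] L2_circle_diff[OF fourier_L2 fourier_sum_L2]]
    by simp
  show "((\<lambda>F. L2_circle_norm (\<lambda>k. fourier \<phi> k + fourier \<psi> k - fourier_sum (coord (\<phi> + \<psi>)) F k))
      \<longlongrightarrow> 0) (finite_subsets_at_top UNIV)"
    by (rule Lim_null_comparison[OF always_eventually lim]) (use le in simp)
qed (intro L2_circle_add fourier_L2)

lemma fourier_cscale: "AE k in circle. fourier (cscale c \<psi>) k = c * fourier \<psi> k"
proof (rule AE_fourier_eqI)
  let ?d = "\<lambda>F k. fourier \<psi> k - fourier_sum (coord \<psi>) F k"
  have lim: "((\<lambda>F. cmod c * L2_circle_norm (?d F)) \<longlongrightarrow> 0) (finite_subsets_at_top UNIV)"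
    by (intro tendsto_mult_right_zero fourier_limit)
  have "(\<lambda>k. c * fourier \<psi> k - fourier_sum (coord (cscale c \<psi>)) F k) = (\<lambda>k. c * ?d F k)" for F
    by (auto simp: fourier_sum_def algebra_simps sum_distrib_left)
  then have le: "L2_circle_norm (\<lambda>k. c * fourier \<psi> k - fourier_sum (coord (cscale c \<psi>)) F k)
      \<le> cmod c * L2_circle_norm (?d F)" for F
    using L2_circle_cmult(2)[OF L2_circle_diff[OF fourier_L2 fourier_sum_L2]] by simp
  show "((\<lambda>F. L2_circle_norm (\<lambda>k. c * fourier \<psi> k - fourier_sum (coord (cscale c \<psi>)) F k))
      \<longlongrightarrow> 0) (finite_subsets_at_top UNIV)"
    by (rule Lim_null_comparison[OF always_eventually lim]) (use le in simp)
qed (intro L2_circle_cmult fourier_L2)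

lemma fourier_diff: "AE k in circle. fourier (\<phi> - \<psi>) k = fourier \<phi> k - fourier \<psi> k"
proof -
  have eq: "\<phi> - \<psi> = \<phi> + cscale (-1) \<psi>"
    by (rule ell2_eqI) simp
  show ?thesis
    unfolding eq using fourier_add[of \<phi> "cscale (-1) \<psi>"] fourier_cscale[of "-1" \<psi>]
    by eventually_elim simp
qed

text \<open>The partial sum of the translate over \<open>F\<close> is \<open>?e\<close> times the
  original partial sum over \<open>F\<close> moved by \<open>-\<alpha>\<close>. As \<open>?e\<close>
  has modulus one, the two errors have the same norm, and moving \<open>F\<close> does not change
  the limit along finite sets.\<close>

lemma fourier_shift:
  "AE k in circle. fourier (shift \<alpha> \<psi>) k = exp (- (\<i> * of_real k * of_int \<alpha>)) * fourier \<psi> k"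
proof (rule AE_fourier_eqI)
  let ?e = "\<lambda>k::real. exp (- (\<i> * of_real k * of_int \<alpha>))"
  let ?d = "\<lambda>F k. fourier \<psi> k - fourier_sum (coord \<psi>) F k"
  let ?T = "finite_subsets_at_top (UNIV :: int set)"
  have e: "?e \<in> borel_measurable borel" "cmod (?e k) \<le> 1" for k
    by (auto intro!: borel_measurable_continuous_onI continuous_intros)
  show "(\<lambda>k. ?e k * fourier \<psi> k) \<in> L2_circle"
    using e by (intro L2_circle_mult_bounded(1) fourier_L2)
  \<comment> \<open>Translation is a bijection of the integers, so it maps the filter of finite
    subsets to itself.\<close>
  have "filtermap ((`) (\<lambda>n. n - \<alpha>)) ?T = finite_subsets_at_top (range (\<lambda>n. n - \<alpha>))"
    by (intro filtermap_image_finite_subsets_at_top) (simp add: inj_on_def)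
  also have "range (\<lambda>n. n - \<alpha>) = UNIV"
    by (auto intro!: image_eqI[of _ _ "_ + \<alpha>"])
  finally have "((\<lambda>F. L2_circle_norm (?d F)) \<longlongrightarrow> 0) (filtermap ((`) (\<lambda>n. n - \<alpha>)) ?T)"
    using fourier_limit[of \<psi>] by simp
  then have "((\<lambda>F. L2_circle_norm (?d ((\<lambda>n. n - \<alpha>) ` F))) \<longlongrightarrow> 0) ?T"
    by (simp only: filterlim_filtermap)
  moreover have "L2_circle_norm (\<lambda>k. ?e k * fourier \<psi> k - fourier_sum (coord (shift \<alpha> \<psi>)) F k)
      = L2_circle_norm (?d ((\<lambda>n. n - \<alpha>) ` F))" for F
  proof -
    have e_shift: "exp (- (\<i> * of_real k * of_int n)) = ?e k * exp (- (\<i> * of_real k * of_int (n - \<alpha>)))"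
      for k :: real and n
      by (simp add: mult_exp_exp algebra_simps)
    have "fourier_sum (coord (shift \<alpha> \<psi>)) F k
        = ?e k * fourier_sum (coord \<psi>) ((\<lambda>n. n - \<alpha>) ` F) k" for k
      unfolding fourier_sum_def sum_distrib_left
      by (subst sum.reindex, simp add: inj_on_def, intro sum.cong refl, subst e_shift)
        (simp add: shift.rep_eq mult.left_commute)
    then have "?e k * fourier \<psi> k - fourier_sum (coord (shift \<alpha> \<psi>)) F k
        = ?e k * ?d ((\<lambda>n. n - \<alpha>) ` F) k" for k
      by (simp add: right_diff_distrib)
    then show ?thesis
      by (simp add: L2_circle_norm_def norm_mult)
  qed
  ultimately show "((\<lambda>F. L2_circle_norm (\<lambda>k. ?e k * fourier \<psi> k - fourier_sum (coord (shift \<alpha> \<psi>)) F k))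
      \<longlongrightarrow> 0) ?T"
    by simp
qed

lemma fourier_ket: "AE k in circle. fourier (ket m) k = exp (- (\<i> * of_real k * of_int m))"
proof (rule AE_fourier_eqI)
  let ?e = "\<lambda>k::real. exp (- (\<i> * of_real k * of_int m))"
  have e: "fourier_sum (coord (ket m)) F = ?e" if "finite F" "m \<in> F" for F
    using that by (auto simp: fun_eq_iff fourier_sum_def ket.rep_eq if_distrib[of "\<lambda>x. x * _"] cong: if_cong)
  from e[of "{m}"] show "?e \<in> L2_circle"
    using fourier_sum_L2[of "coord (ket m)" "{m}"] by simp
  \<comment> \<open>The error vanishes as soon as \<open>F\<close> contains \<open>m\<close>, so the
    net of errors is eventually constant.\<close>
  have "\<forall>\<^sub>F F in finite_subsets_at_top UNIV.
      L2_circle_norm (\<lambda>k. ?e k - fourier_sum (coord (ket m)) F k) = 0"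
    unfolding eventually_finite_subsets_at_top
    by (intro exI[of _ "{m}"]) (auto simp: e L2_circle_norm_def)
  then show "((\<lambda>F. L2_circle_norm (\<lambda>k. ?e k - fourier_sum (coord (ket m)) F k)) \<longlongrightarrow> 0)
      (finite_subsets_at_top UNIV)"
    by (rule tendsto_eventually)
qed

section \<open>Fourier coefficients and the Parseval identity\<close>

lemma integrable_L2_mult:
  assumes "f \<in> L2_circle" "g \<in> L2_circle"
  shows "integrable circle (\<lambda>k. f k * g k)"
  by (rule Bochner_Integration.integrable_bound[OF L2_circle_Cauchy_Schwarz(1)[OF assms]])
    (use assms in \<open>auto simp: norm_mult dest!: L2_circleD(1)\<close>)

text \<open>Pairing with a fixed square-integrable function is continuous by the Cauchy-Schwarz
  inequality. This reduces integrals of \<open>fourier \<psi>\<close> to finite sums.\<close>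

lemma integral_mult_fourier_limit:
  assumes g: "g \<in> L2_circle"
  shows "((\<lambda>F. \<integral>k. g k * fourier_sum (coord \<psi>) F k \<partial>circle) \<longlongrightarrow> (\<integral>k. g k * fourier \<psi> k \<partial>circle))
    (finite_subsets_at_top UNIV)"
proof (rule LIM_zero_cancel, rule Lim_null_comparison)
  let ?d = "\<lambda>F k. fourier \<psi> k - fourier_sum (coord \<psi>) F k"
  have d: "?d F \<in> L2_circle" for F
    by (intro L2_circle_diff fourier_L2 fourier_sum_L2)
  have "norm ((\<integral>k. g k * fourier_sum (coord \<psi>) F k \<partial>circle) - (\<integral>k. g k * fourier \<psi> k \<partial>circle))
      \<le> L2_circle_norm g * L2_circle_norm (?d F)" for F
  proof -
    have "(\<integral>k. g k * fourier_sum (coord \<psi>) F k \<partial>circle) - (\<integral>k. g k * fourier \<psi> k \<partial>circle)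
        = - (\<integral>k. g k * ?d F k \<partial>circle)"
      by (simp add: right_diff_distrib integrable_L2_mult g fourier_L2 fourier_sum_L2)
    also have "norm \<dots> \<le> (\<integral>k. cmod (g k) * cmod (?d F k) \<partial>circle)"
      using integral_norm_bound[of circle "\<lambda>k. g k * ?d F k"] by (simp add: norm_mult)
    also have "\<dots> \<le> L2_circle_norm g * L2_circle_norm (?d F)"
      by (intro L2_circle_Cauchy_Schwarz g d)
    finally show ?thesis .
  qed
  then show "\<forall>\<^sub>F F in finite_subsets_at_top UNIV.
      norm ((\<integral>k. g k * fourier_sum (coord \<psi>) F k \<partial>circle) - (\<integral>k. g k * fourier \<psi> k \<partial>circle))
      \<le> L2_circle_norm g * L2_circle_norm (?d F)"
    by simp
  show "((\<lambda>F. L2_circle_norm g * L2_circle_norm (?d F)) \<longlongrightarrow> 0) (finite_subsets_at_top UNIV)"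
    by (rule tendsto_mult_right_zero[OF fourier_limit])
qed

lemma exp_L2: "(\<lambda>k::real. exp (\<i> * of_real k * of_int n)) \<in> L2_circle"
  \<comment> \<open>The index \<open>-n\<close> undoes the minus sign in the exponent of
    \<open>fourier_sum\<close>.\<close>
  using fourier_sum_L2[of "\<lambda>_. 1" "{-n}"] by (simp add: fourier_sum_def[abs_def])

lemma integral_mult_fourier_sum:
  assumes g: "g \<in> L2_circle"
  shows "(\<integral>k. g k * fourier_sum \<psi> F k \<partial>circle)
    = (\<Sum>n\<in>F. \<psi> n * (\<integral>k. g k * exp (- (\<i> * of_real k * of_int n)) \<partial>circle))"
proof -
  have int: "integrable circle (\<lambda>k. g k * exp (- (\<i> * of_real k * of_int n)))" for n
    using integrable_L2_mult[OF g exp_L2[of "-n"]] by simp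
  have "(\<integral>k. g k * fourier_sum \<psi> F k \<partial>circle)
      = (\<integral>k. (\<Sum>n\<in>F. \<psi> n * (g k * exp (- (\<i> * of_real k * of_int n)))) \<partial>circle)"
    by (simp add: fourier_sum_def sum_distrib_left mult.left_commute)
  also have "\<dots> = (\<Sum>n\<in>F. \<psi> n * (\<integral>k. g k * exp (- (\<i> * of_real k * of_int n)) \<partial>circle))"
    by (subst Bochner_Integration.integral_sum) (auto intro!: integrable_mult_right int)
  finally show ?thesis .
qed

text \<open>This is the inversion formula. By orthonormality of the exponentials, the pairing with a
  partial sum already equals the coefficient once \<open>n\<close> lies in \<open>F\<close>.\<close>

lemma fourier_coefficient:
  "(\<integral>k. exp (\<i> * of_real k * of_int n) * fourier \<psi> k \<partial>circle) = coord \<psi> n"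
proof (rule tendsto_unique[OF _ integral_mult_fourier_limit[OF exp_L2]])
  have eq: "(\<integral>k. exp (\<i> * of_real k * of_int n) * exp (- (\<i> * of_real k * of_int m)) \<partial>circle)
      = (if m = n then 1 else 0)" for m
  proof -
    have "exp (\<i> * of_real k * of_int n) * exp (- (\<i> * of_real k * of_int m))
        = exp (\<i> * of_real k * of_int (n - m))" for k
      by (simp add: exp_add[symmetric] algebra_simps)
    then show ?thesis
      by (simp only: integral_circle_exp) auto
  qed
  have "\<forall>\<^sub>F F in finite_subsets_at_top UNIV.
      (\<integral>k. exp (\<i> * of_real k * of_int n) * fourier_sum (coord \<psi>) F k \<partial>circle) = coord \<psi> n"
    unfolding eventually_finite_subsets_at_top
    by (intro exI[of _ "{n}"])
      (auto simp: integral_mult_fourier_sum[OF exp_L2] eq if_distrib[of "\<lambda>x. _ * x"] cong: if_cong)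
  then show "((\<lambda>F. \<integral>k. exp (\<i> * of_real k * of_int n) * fourier_sum (coord \<psi>) F k \<partial>circle)
      \<longlongrightarrow> coord \<psi> n) (finite_subsets_at_top UNIV)"
    by (rule tendsto_eventually)
qed simp

lemma cnj_L2: "f \<in> L2_circle \<Longrightarrow> (\<lambda>k. cnj (f k)) \<in> L2_circle"
  by (auto simp: L2_circle_def
      intro!: measurable_compose[OF _ borel_measurable_continuous_onI[of cnj]] continuous_intros)

text \<open>Conjugating the inversion formula for \<phi> turns the pairings with partial sums of
  \<psi> into partial sums of \<open>cinner \<phi> \<psi>\<close>; both limits along finite sets
  must agree.\<close>

lemma parseval: "(\<integral>k. cnj (fourier \<phi> k) * fourier \<psi> k \<partial>circle) = cinner \<phi> \<psi>"
proof (rule tendsto_unique[OF _ integral_mult_fourier_limit[OF cnj_L2[OF fourier_L2]]])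
  have "(\<integral>k. cnj (fourier \<phi> k) * exp (- (\<i> * of_real k * of_int n)) \<partial>circle) = cnj (coord \<phi> n)" for n
  proof -
    have "cnj (coord \<phi> n) = (\<integral>k. cnj (exp (\<i> * of_real k * of_int n) * fourier \<phi> k) \<partial>circle)"
      unfolding fourier_coefficient[of n \<phi>, symmetric] by (rule Bochner_Integration.integral_cnj[symmetric])
    then show ?thesis
      by (simp add: exp_cnj mult.commute)
  qed
  then show "((\<lambda>F. \<integral>k. cnj (fourier \<phi> k) * fourier_sum (coord \<psi>) F k \<partial>circle) \<longlongrightarrow> cinner \<phi> \<psi>)
      (finite_subsets_at_top UNIV)"
    using has_sum_infsum[OF summable_cinner[of \<phi> \<psi>]]
    by (simp add: integral_mult_fourier_sum[OF cnj_L2[OF fourier_L2]] has_sum_def cinner_def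
        mult.commute[of "coord \<psi> _"])
qed simp

lemma fourier_isometry: "L2_circle_norm (fourier \<psi>) = norm \<psi>"
proof -
  have "complex_of_real (\<integral>k. (cmod (fourier \<psi> k))\<^sup>2 \<partial>circle) = cinner \<psi> \<psi>"
    unfolding parseval[symmetric] integral_complex_of_real[symmetric]
    by (intro Bochner_Integration.integral_cong refl)
      (metis complex_norm_square mult.commute)
  then show ?thesis
    by (simp add: cinner_self L2_circle_norm_def norm_ell2_def del: of_real_power)
qed

text \<open>The inversion formula recovers each coordinate by an integral, which ignores null sets.
  Identities between vectors can therefore be checked for almost every \<open>k\<close>.\<close>

lemma fourier_inject:
  assumes "AE k in circle. fourier \<phi> k = fourier \<psi> k"
  shows "\<phi> = \<psi>"
proof (rule ell2_eqI)
  fix n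
  show "coord \<phi> n = coord \<psi> n"
    unfolding fourier_coefficient[symmetric]
    by (rule integral_cong_AE) (use assms in \<open>auto intro!: borel_measurable_times L2_circleD(1)[OF fourier_L2] L2_circleD(1)[OF exp_L2]\<close>)
qed

section \<open>Fourier multipliers\<close>

text \<open>A bound on \<open>m\<close> keeps products with \<open>m\<close> square-integrable. The
  exceptional null set may depend on \<psi>, since each transform is fixed only almost everywhere.
  Linearity and boundedness of \<open>A\<close> are consequences.\<close>

definition fourier_multiplier :: "(ell2 \<Rightarrow> ell2) \<Rightarrow> (real \<Rightarrow> complex) \<Rightarrow> bool" where
  "fourier_multiplier A m \<longleftrightarrow> m \<in> borel_measurable borel \<and> (\<exists>C. \<forall>k. cmod (m k) \<le> C) \<and>
     (\<forall>\<psi>. AE k in circle. fourier (A \<psi>) k = m k * fourier \<psi> k)"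

lemma fourier_multiplierD:
  assumes "fourier_multiplier A m"
  shows "m \<in> borel_measurable borel" "AE k in circle. fourier (A \<psi>) k = m k * fourier \<psi> k"
  using assms by (auto simp: fourier_multiplier_def)

lemma fourier_multiplier_bounded:
  assumes "fourier_multiplier A m"
  obtains C where "\<And>k. cmod (m k) \<le> C"
  using assms by (auto simp: fourier_multiplier_def)

lemma fourier_multiplierI:
  assumes "m \<in> borel_measurable borel" "\<And>k. cmod (m k) \<le> C"
    "\<And>\<psi>. AE k in circle. fourier (A \<psi>) k = m k * fourier \<psi> k"
  shows "fourier_multiplier A m"
  using assms by (auto simp: fourier_multiplier_def)

lemma fourier_multiplier_unique:
  assumes "fourier_multiplier A m" "fourier_multiplier B m"
  shows "A = B"
proof
  fix \<psi>
  show "A \<psi> = B \<psi>"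
    by (rule fourier_inject)
      (use fourier_multiplierD(2)[OF assms(1), of \<psi>] fourier_multiplierD(2)[OF assms(2), of \<psi>] in eventually_elim, simp)
qed

lemma fourier_multiplier_id: "fourier_multiplier (\<lambda>\<psi>. \<psi>) (\<lambda>_. 1)"
  by (rule fourier_multiplierI[where C = 1]) auto

lemma fourier_multiplier_0: "fourier_multiplier (\<lambda>_. 0) (\<lambda>_. 0)"
  by (rule fourier_multiplierI[where C = 0]) (use fourier_cscale[of 0 0] in \<open>auto simp: cscale_def zero_ell2_def\<close>)

lemma fourier_multiplier_shift:
  "fourier_multiplier (shift \<alpha>) (\<lambda>k. exp (- (\<i> * of_real k * of_int \<alpha>)))"
  by (rule fourier_multiplierI[where C = 1])
    (auto intro!: fourier_shift borel_measurable_continuous_onI continuous_intros)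

lemma fourier_multiplier_compose:
  assumes A: "fourier_multiplier A m" and B: "fourier_multiplier B m'"
  shows "fourier_multiplier (\<lambda>\<psi>. A (B \<psi>)) (\<lambda>k. m k * m' k)"
proof -
  obtain C C' where "\<And>k. cmod (m k) \<le> C" "\<And>k. cmod (m' k) \<le> C'"
    using fourier_multiplier_bounded[OF A] fourier_multiplier_bounded[OF B] by metis
  \<comment> \<open>The sign of \<open>C\<close> is what lets the two bounds be multiplied
    monotonically.\<close>
  moreover from this(1)[of 0] have "0 \<le> C"
    using norm_ge_zero[of "m 0"] by linarith
  ultimately show ?thesis
  proof (intro fourier_multiplierI[where C = "C * C'"])
    fix \<psi>
    show "AE k in circle. fourier (A (B \<psi>)) k = m k * m' k * fourier \<psi> k"
      using fourier_multiplierD(2)[OF A, of "B \<psi>"] fourier_multiplierD(2)[OF B, of \<psi>]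
      by eventually_elim simp
  qed (use fourier_multiplierD(1)[OF A] fourier_multiplierD(1)[OF B] in
      \<open>auto simp: norm_mult intro!: mult_mono\<close>)
qed

lemma fourier_multiplier_add:
  assumes A: "fourier_multiplier A m" and B: "fourier_multiplier B m'"
  shows "fourier_multiplier (\<lambda>\<psi>. A \<psi> + B \<psi>) (\<lambda>k. m k + m' k)"
proof -
  obtain C C' where C: "\<And>k. cmod (m k) \<le> C" "\<And>k. cmod (m' k) \<le> C'"
    using fourier_multiplier_bounded[OF A] fourier_multiplier_bounded[OF B] by metis
  show ?thesis
  proof (rule fourier_multiplierI[where C = "C + C'"])
    fix \<psi>
    show "AE k in circle. fourier (A \<psi> + B \<psi>) k = (m k + m' k) * fourier \<psi> k"
      using fourier_multiplierD(2)[OF A, of \<psi>] fourier_multiplierD(2)[OF B, of \<psi>]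
        fourier_add[of "A \<psi>" "B \<psi>"]
      by eventually_elim (simp add: distrib_right)
  next
    fix k
    show "cmod (m k + m' k) \<le> C + C'"
      by (intro norm_triangle_mono C)
  qed (intro borel_measurable_add fourier_multiplierD[OF A] fourier_multiplierD[OF B])
qed

lemma fourier_multiplier_cscale:
  assumes "fourier_multiplier A m"
  shows "fourier_multiplier (\<lambda>\<psi>. cscale c (A \<psi>)) (\<lambda>k. c * m k)"
proof (rule fourier_multiplier_compose[OF _ assms])
  show "fourier_multiplier (cscale c) (\<lambda>_. c)"
    by (rule fourier_multiplierI[where C = "cmod c"]) (auto intro: fourier_cscale)
qed

lemma fourier_multiplier_diff:
  assumes "fourier_multiplier A m" "fourier_multiplier B m'"
  shows "fourier_multiplier (\<lambda>\<psi>. A \<psi> - B \<psi>) (\<lambda>k. m k - m' k)"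
proof -
  have eq: "A \<psi> - B \<psi> = A \<psi> + cscale (-1) (B \<psi>)" for \<psi>
    by (rule ell2_eqI) simp
  show ?thesis
    unfolding eq
    using fourier_multiplier_add[OF assms(1) fourier_multiplier_cscale[OF assms(2), of "-1"]] by simp
qed

lemma fourier_multiplier_sum:
  assumes "\<And>i. i \<in> I \<Longrightarrow> fourier_multiplier (A i) (m i)"
  shows "fourier_multiplier (\<lambda>\<psi>. \<Sum>i\<in>I. A i \<psi>) (\<lambda>k. \<Sum>i\<in>I. m i k)"
  using assms
  by (induction I rule: infinite_finite_induct)
    (auto intro: fourier_multiplier_add fourier_multiplier_0)

section \<open>Norm bounds, linearity, adjoints and limits of multipliers\<close>

lemma fourier_multiplier_norm_le:
  assumes A: "fourier_multiplier A m" and C: "\<And>k. cmod (m k) \<le> C"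
  shows "norm (A \<psi>) \<le> C * norm \<psi>"
proof -
  \<comment> \<open>The isometry is used on both sides: it moves the norm to the circle, where the
    bound on \<open>m\<close> applies, and back.\<close>
  have "norm (A \<psi>) = L2_circle_norm (\<lambda>k. m k * fourier \<psi> k)"
    unfolding fourier_isometry[of "A \<psi>", symmetric]
    using fourier_multiplierD[OF A] L2_circleD(1)[OF fourier_L2]
    by (intro L2_circle_norm_cong_AE) auto
  also have "\<dots> \<le> C * norm \<psi>"
    unfolding fourier_isometry[of \<psi>, symmetric]
    by (intro L2_circle_mult_bounded fourier_L2 fourier_multiplierD[OF A] C)
  finally show ?thesis .
qed

text \<open>Pointwise multiplication is linear, and injectivity of the transform carries this over
  to \<open>A\<close>.\<close>

lemma fourier_multiplier_bounded_clinear: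
  assumes A: "fourier_multiplier A m"
  shows "bounded_clinear A"
proof -
  have cscale: "A (cscale c \<psi>) = cscale c (A \<psi>)" for c \<psi>
  proof (rule fourier_inject)
    show "AE k in circle. fourier (A (cscale c \<psi>)) k = fourier (cscale c (A \<psi>)) k"
      using fourier_multiplierD(2)[OF A, of "cscale c \<psi>"] fourier_multiplierD(2)[OF A, of \<psi>]
        fourier_cscale[of c \<psi>] fourier_cscale[of c "A \<psi>"]
      by eventually_elim simp
  qed
  have add: "A (\<phi> + \<psi>) = A \<phi> + A \<psi>" for \<phi> \<psi>
  proof (rule fourier_inject)
    show "AE k in circle. fourier (A (\<phi> + \<psi>)) k = fourier (A \<phi> + A \<psi>) k"
      using fourier_multiplierD(2)[OF A, of "\<phi> + \<psi>"] fourier_multiplierD(2)[OF A, of \<phi>]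
        fourier_multiplierD(2)[OF A, of \<psi>] fourier_add[of \<phi> \<psi>] fourier_add[of "A \<phi>" "A \<psi>"]
      by eventually_elim (simp add: distrib_left)
  qed
  obtain C where C: "\<And>k. cmod (m k) \<le> C"
    using fourier_multiplier_bounded[OF A] by metis
  have "bounded_linear A"
    by (rule bounded_linear_intro[where K = C])
      (use fourier_multiplier_norm_le[OF A C] in \<open>auto simp: add cscale scaleR_ell2_def mult.commute\<close>)
  with cscale show ?thesis
    by (simp add: bounded_clinear_def)
qed

text \<open>Under the Parseval identity, \<open>m\<close> moves from the second factor to the first,
  where it appears conjugated.\<close>

lemma fourier_multiplier_adjoint:
  assumes A: "fourier_multiplier A m" and B: "fourier_multiplier B (\<lambda>k. cnj (m k))"
  shows "cinner \<phi> (A \<psi>) = cinner (B \<phi>) \<psi>"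
proof -
  note [measurable] = L2_circleD(1)[OF fourier_L2] L2_circleD(1)[OF cnj_L2[OF fourier_L2]]
  show ?thesis
    unfolding parseval[symmetric]
  proof (rule integral_cong_AE)
    show "AE k in circle. cnj (fourier \<phi> k) * fourier (A \<psi>) k = cnj (fourier (B \<phi>) k) * fourier \<psi> k"
      using fourier_multiplierD(2)[OF A, of \<psi>] fourier_multiplierD(2)[OF B, of \<phi>]
      by eventually_elim simp
  qed simp_all
qed

text \<open>Compare \<open>fourier (B \<psi>)\<close> and \<open>n\<close> times
  \<open>fourier \<psi>\<close> through the product with \<open>m j\<close>. The isometry turns the
  first error into the norm of \<open>B \<psi> - A j \<psi>\<close>; the second is at most the
  uniform distance of \<open>m j\<close> and \<open>n\<close> times the norm of \<psi>. The filter
  is general because it is applied both to finite sets and to sequences.\<close>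

lemma fourier_multiplier_limit:
  assumes A: "\<And>j. fourier_multiplier (A j) (m j)"
    and lim: "\<And>\<psi>. ((\<lambda>j. A j \<psi>) \<longlongrightarrow> B \<psi>) F"
    and unif: "uniform_limit UNIV m n F"
    and n: "n \<in> borel_measurable borel"
    and F: "F \<noteq> bot"
  shows "fourier_multiplier B n"
proof -
  \<comment> \<open>One approximant within distance 1 suffices to bound \<open>n\<close>.\<close>
  obtain j where j: "\<And>k. cmod (m j k - n k) < 1"
    using eventually_happens[OF uniform_limitD[OF unif zero_less_one]] F by (auto simp: dist_norm)
  obtain C where C: "\<And>k. cmod (m j k) \<le> C"
    using fourier_multiplier_bounded[OF A[of j]] by metis
  have bound: "cmod (n k) \<le> C + 1" for k
    using C[of k] j[of k] norm_triangle_ineq2[of "n k" "m j k"] by (simp add: norm_minus_commute)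
  note nL2 = L2_circle_mult_bounded(1)[OF fourier_L2 n bound]
  show ?thesis
  proof (rule fourier_multiplierI[OF n bound])
    fix \<psi>
    let ?D = "L2_circle_norm (\<lambda>k. fourier (B \<psi>) k - n k * fourier \<psi> k)"
    have small: "?D \<le> e * (1 + norm \<psi>)" if "e > 0" for e
    proof -
      \<comment> \<open>Both errors have to be small for the same index, which exists because the
        filter is proper.\<close>
      have "\<forall>\<^sub>F j in F. norm (A j \<psi> - B \<psi>) < e \<and> (\<forall>k\<in>UNIV. dist (m j k) (n k) < e)"
        using tendstoD[OF lim \<open>e > 0\<close>] uniform_limitD[OF unif \<open>e > 0\<close>]
        by eventually_elim (simp add: dist_norm)
      from eventually_happens[OF this] F obtain j
        where j: "norm (A j \<psi> - B \<psi>) < e" "\<And>k. cmod (m j k - n k) < e"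
        by (auto simp: dist_norm)
      have mL2: "(\<lambda>k. m j k * fourier \<psi> k) \<in> L2_circle"
        using fourier_multiplier_bounded[OF A[of j]] fourier_multiplierD(1)[OF A[of j]] fourier_L2
          L2_circle_mult_bounded(1) by metis
      have "?D \<le> L2_circle_norm (\<lambda>k. fourier (B \<psi>) k - m j k * fourier \<psi> k)
          + L2_circle_norm (\<lambda>k. n k * fourier \<psi> k - m j k * fourier \<psi> k)"
        by (intro L2_circle_norm_triangle fourier_L2 nL2 mL2)
      also have "L2_circle_norm (\<lambda>k. fourier (B \<psi>) k - m j k * fourier \<psi> k)
          = L2_circle_norm (fourier (B \<psi> - A j \<psi>))"
      proof (rule L2_circle_norm_cong_AE)
        show "AE k in circle. fourier (B \<psi>) k - m j k * fourier \<psi> k = fourier (B \<psi> - A j \<psi>) k"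
          using fourier_diff[of "B \<psi>" "A j \<psi>"] fourier_multiplierD(2)[OF A[of j], of \<psi>]
          by eventually_elim simp
      qed (intro L2_circleD L2_circle_diff fourier_L2 mL2)+
      also have "\<dots> \<le> e"
        unfolding fourier_isometry using j(1) by (simp add: norm_minus_commute)
      also have "(\<lambda>k. n k * fourier \<psi> k - m j k * fourier \<psi> k) = (\<lambda>k. (n k - m j k) * fourier \<psi> k)"
        by (simp add: left_diff_distrib)
      also have "L2_circle_norm \<dots> \<le> e * L2_circle_norm (fourier \<psi>)"
        using j(2) by (intro L2_circle_mult_bounded fourier_L2 borel_measurable_diff n
            fourier_multiplierD[OF A]) (simp add: norm_minus_commute less_imp_le)
      finally show ?thesis
        by (simp add: fourier_isometry distrib_left)
    qed
    \<comment> \<open>The factor \<open>1 + norm \<psi>\<close> is absorbed by rescaling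
      \<open>e\<close>; the summand 1 keeps the divisor positive even for \<psi> = 0.\<close>
    have "?D \<le> 0"
    proof (rule field_le_epsilon)
      fix e :: real
      assume "e > 0"
      moreover have "1 + norm \<psi> > 0"
        by (simp add: add_pos_nonneg)
      ultimately show "?D \<le> 0 + e"
        using small[of "e / (1 + norm \<psi>)"] by simp
    qed
    then have "AE k in circle. fourier (B \<psi>) k - n k * fourier \<psi> k = 0"
      by (intro L2_circle_norm_eq_0 L2_circle_diff fourier_L2 nL2)
    then show "AE k in circle. fourier (B \<psi>) k = n k * fourier \<psi> k"
      by simp
  qed
qed

section \<open>Matrix elements of a multiplier\<close>

lemma cinner_ket: "cinner (ket n) \<psi> = coord \<psi> n"
proof -
  have "cinner (ket n) \<psi> = (\<Sum>\<^sub>\<infinity>i\<in>{n}. coord \<psi> i)"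
    unfolding cinner_def by (rule infsum_cong_neutral) (auto simp: ket.rep_eq)
  then show ?thesis by simp
qed

text \<open>The matrix element is the coefficient at \<open>n\<close> of the transform of
  \<open>A (ket l)\<close>, and that transform is \<open>m\<close> times the exponential of
  \<open>ket l\<close>. The two exponentials combine into one that sees only
  \<open>n - l\<close>.\<close>

lemma fourier_multiplier_kernel:
  assumes A: "fourier_multiplier A m" and m: "continuous_on UNIV m"
  shows "cinner (ket n) (A (ket l))
    = 1 / (2 * of_real pi) * integral {-pi..pi} (\<lambda>k. exp (\<i> * of_real k * of_int (n - l)) * m k)"
proof -
  let ?g = "\<lambda>k. exp (\<i> * of_real k * of_int (n - l)) * m k"
  \<comment> \<open>Continuity on the whole line gives measurability, and on the compact interval it
    gives integrability.\<close>
  have cont: "continuous_on S ?g" for S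
    by (intro continuous_intros continuous_on_subset[OF m]) auto
  have meas: "?g \<in> borel_measurable borel"
    by (intro borel_measurable_continuous_onI cont)
  have "cinner (ket n) (A (ket l)) = (\<integral>k. exp (\<i> * of_real k * of_int n) * fourier (A (ket l)) k \<partial>circle)"
    by (simp add: cinner_ket fourier_coefficient)
  also have "\<dots> = (\<integral>k. ?g k \<partial>circle)"
  proof (rule integral_cong_AE)
    show "AE k in circle. exp (\<i> * of_real k * of_int n) * fourier (A (ket l)) k = ?g k"
      using fourier_multiplierD(2)[OF A, of "ket l"] fourier_ket[of l]
    proof eventually_elim
      case (elim k)
      have "exp (\<i> * of_real k * of_int n) * exp (- (\<i> * of_real k * of_int l))
          = exp (\<i> * of_real k * of_int (n - l))"
        by (simp add: mult_exp_exp algebra_simps)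
      with elim show ?case
        by (metis mult.assoc mult.commute)
    qed
    show "(\<lambda>k. exp (\<i> * of_real k * of_int n) * fourier (A (ket l)) k) \<in> borel_measurable circle"
      unfolding circle_measurable
      by (intro borel_measurable_times L2_circleD(1)[OF exp_L2] L2_circleD(1)[OF fourier_L2])
  qed (simp only: circle_measurable meas)
  also have "\<dots> = (1 / (2 * pi)) *\<^sub>R (\<integral>k. indicator {-pi..pi} k *\<^sub>R ?g k \<partial>lborel)"
    by (rule integral_circle[OF meas])
  \<comment> \<open>For a continuous function on a compact interval the Lebesgue integral agrees
    with the gauge integral \<open>integral\<close>.\<close>
  also have "(\<integral>k. indicator {-pi..pi} k *\<^sub>R ?g k \<partial>lborel) = integral {-pi..pi} ?g"
    using set_borel_integral_eq_integral(2)[OF borel_integrable_atLeastAtMost'[OF cont]]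
    by (simp add: set_lebesgue_integral_def)
  finally show ?thesis
    by (simp add: scaleR_conv_of_real)
qed

section \<open>Exponentials\<close>

text \<open>Submultiplicativity of the operator norm bounds the series by the real exponential
  series of \<open>norm A\<close>. The identity is only bounded by 1, as its norm is 0 on a trivial
  space.\<close>

lemma summable_exp_term:
  fixes A :: "'a::banach \<Rightarrow>\<^sub>L 'a"
  shows "summable (exp_term A)"
proof (rule summable_comparison_test)
  have "norm (((\<lambda>B. A o\<^sub>L B) ^^ n) id_blinfun) \<le> norm A ^ n" for n
  proof (induction n)
    case (Suc n)
    have "norm (((\<lambda>B. A o\<^sub>L B) ^^ Suc n) id_blinfun)
        \<le> norm A * norm (((\<lambda>B. A o\<^sub>L B) ^^ n) id_blinfun)"
      by (simp add: norm_blinfun_compose)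
    also have "\<dots> \<le> norm A * norm A ^ n"
      by (intro mult_left_mono Suc.IH) simp
    finally show ?case by simp
  qed (simp add: norm_blinfun_id_le)
  then show "\<exists>N. \<forall>n\<ge>N. norm (exp_term A n) \<le> norm A ^ n /\<^sub>R fact n"
    by (auto simp: exp_term_def intro!: mult_left_mono)
  show "summable (\<lambda>n. norm A ^ n /\<^sub>R fact n)"
    by (rule summable_exp_generic)
qed

text \<open>Powers of \<open>A\<close> multiply by powers of \<open>a\<close>, so partial sums of
  one exponential series correspond to partial sums of the other. Operator norm convergence gives
  convergence on each vector, and boundedness of \<open>a\<close> gives uniform convergence of the
  functions.\<close>

lemma fourier_multiplier_op_exp:
  assumes A: "fourier_multiplier (blinfun_apply A) a"
  shows "fourier_multiplier (blinfun_apply (op_exp A)) (\<lambda>k. exp (a k))"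
proof (rule fourier_multiplier_limit[where F = sequentially])
  obtain C where C: "\<And>k. cmod (a k) \<le> C"
    using fourier_multiplier_bounded[OF A] by metis
  have pow: "fourier_multiplier (blinfun_apply (((\<lambda>B. A o\<^sub>L B) ^^ n) id_blinfun)) (\<lambda>k. a k ^ n)" for n
  proof (induction n)
    case 0
    then show ?case using fourier_multiplier_id by (simp add: id_def)
  next
    case (Suc n)
    then show ?case using fourier_multiplier_compose[OF A Suc.IH] by simp
  qed
  have summand: "fourier_multiplier (blinfun_apply (exp_term A n)) (\<lambda>k. a k ^ n /\<^sub>R fact n)" for n
  proof -
    \<comment> \<open>Real scaling on \<open>ell2\<close> is defined by \<open>cscale\<close>, so
      the factorial is handled by closure under complex multiples.\<close>
    have "blinfun_apply (exp_term A n)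
        = (\<lambda>\<psi>. cscale (of_real (inverse (fact n))) (blinfun_apply (((\<lambda>B. A o\<^sub>L B) ^^ n) id_blinfun) \<psi>))"
      by (rule ext) (simp only: exp_term_def scaleR_ell2_def blinfun.scaleR_left)
    then show ?thesis
      using fourier_multiplier_cscale[OF pow[of n], of "of_real (inverse (fact n))"]
      by (simp only: scaleR_conv_of_real)
  qed
  show "fourier_multiplier (\<lambda>\<psi>. \<Sum>n<N. blinfun_apply (exp_term A n) \<psi>)
      (\<lambda>k. \<Sum>n<N. a k ^ n /\<^sub>R fact n)" for N
    by (intro fourier_multiplier_sum summand)
  show "(\<lambda>N. \<Sum>n<N. blinfun_apply (exp_term A n) \<psi>) \<longlonglongrightarrow> blinfun_apply (op_exp A) \<psi>" for \<psi>
    using bounded_linear.sums[OF blinfun.bounded_linear_left summable_sums[OF summable_exp_term]]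
    by (simp add: sums_def op_exp_def)
  have "uniform_limit UNIV (\<lambda>N k. \<Sum>n<N. a k ^ n /\<^sub>R fact n) (\<lambda>k. \<Sum>n. a k ^ n /\<^sub>R fact n) sequentially"
  proof (rule Weierstrass_m_test)
    show "norm (a k ^ n /\<^sub>R fact n) \<le> C ^ n /\<^sub>R fact n" for k n
      by (auto simp: norm_power intro!: mult_left_mono power_mono C)
    show "summable (\<lambda>n. C ^ n /\<^sub>R fact n)"
      by (rule summable_exp_generic)
  qed
  then show "uniform_limit UNIV (\<lambda>N k. \<Sum>n<N. a k ^ n /\<^sub>R fact n) (\<lambda>k. exp (a k)) sequentially"
    by (simp add: exp_def)
  show "(\<lambda>k. exp (a k)) \<in> borel_measurable borel"
    by (rule measurable_compose[OF fourier_multiplierD(1)[OF A] borel_measurable_continuous_onI[of exp]])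
      (intro continuous_intros)
qed simp

section \<open>Unitary groups with real bounded frequencies\<close>

lemma cmod_exp_i_diff_le: "cmod (exp (\<i> * of_real x) - exp (\<i> * of_real y)) \<le> \<bar>x - y\<bar>"
proof -
  have "exp (\<i> * of_real x) - exp (\<i> * of_real y)
      = exp (\<i> * of_real y) * (exp (\<i> * of_real (x - y)) - 1)"
    by (simp add: right_diff_distrib mult_exp_exp)
  \<comment> \<open>A chord of the unit circle is twice the sine of half its angle.\<close>
  then have "cmod (exp (\<i> * of_real x) - exp (\<i> * of_real y)) = 2 * \<bar>sin ((x - y) / 2)\<bar>"
    by (simp only: norm_mult norm_exp_i_times dist_exp_i_1 mult_1)
  also have "\<dots> \<le> \<bar>x - y\<bar>"
    using abs_sin_x_le_abs_x[of "(x - y) / 2"] by simp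
  finally show ?thesis .
qed

text \<open>The group law is the functional equation of the exponential. Since \<open>w\<close> is
  real, the multiplier of \<open>U (- t)\<close> is the conjugate of that of \<open>U t\<close>, so
  the inverse is the adjoint. The bound on \<open>w\<close> gives a Lipschitz estimate in time,
  hence strong continuity.\<close>

lemma unitary_group_multiplier:
  assumes U: "\<And>t. fourier_multiplier (U t) (\<lambda>k. exp (\<i> * of_real (w k * t)))"
    and w: "\<And>k. \<bar>w k\<bar> \<le> C"
  shows "unitary_group U"
proof -
  have id: "U 0 = id"
    using fourier_multiplier_unique[OF U[of 0]] fourier_multiplier_id by (simp add: id_def)
  have add: "U (s + t) = U s \<circ> U t" for s t
  proof (rule fourier_multiplier_unique[OF U])
    show "fourier_multiplier (U s \<circ> U t) (\<lambda>k. exp (\<i> * of_real (w k * (s + t))))"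
      using fourier_multiplier_compose[OF U[of s] U[of t]]
      by (simp add: o_def mult_exp_exp distrib_left)
  qed
  have inv: "U s \<circ> U (- s) = id" for s
    using add[of s "- s"] id by simp
  have "bij (U t)" for t
    using inv[of t] inv[of "- t"] by (intro o_bij[of "U (- t)"]) simp_all
  moreover have "cinner (U t \<phi>) (U t \<psi>) = cinner \<phi> \<psi>" for t \<phi> \<psi>
  proof -
    have "fourier_multiplier (U (- t)) (\<lambda>k. cnj (exp (\<i> * of_real (w k * t))))"
      using U[of "- t"] by (simp add: exp_cnj)
    from fourier_multiplier_adjoint[OF U this, of "U t \<phi>" \<psi>]
    have "cinner (U t \<phi>) (U t \<psi>) = cinner ((U (- t) \<circ> U t) \<phi>) \<psi>"
      by simp
    then show ?thesis
      using fun_cong[OF inv[of "- t"], of \<phi>] by simp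
  qed
  ultimately have unitary: "unitary (U t)" for t
    by (simp add: unitary_def fourier_multiplier_bounded_clinear[OF U])
  have "continuous_on UNIV (\<lambda>t. U t \<psi>)" for \<psi>
  proof -
    \<comment> \<open>The difference is itself a multiplier, so its norm is controlled by the
      pointwise distance of the two phases.\<close>
    have "norm (U s \<psi> - U t \<psi>) \<le> (C * norm \<psi>) * \<bar>s - t\<bar>" for s t
    proof -
      have "cmod (exp (\<i> * of_real (w k * s)) - exp (\<i> * of_real (w k * t))) \<le> C * \<bar>s - t\<bar>" for k
        using cmod_exp_i_diff_le[of "w k * s" "w k * t"] mult_right_mono[OF w[of k], of "\<bar>s - t\<bar>"]
        by (simp add: right_diff_distrib[symmetric] abs_mult)
      from fourier_multiplier_norm_le[OF fourier_multiplier_diff[OF U U] this]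
      show ?thesis by (simp add: mult_ac)
    qed
    moreover have "0 \<le> C * norm \<psi>"
      using w[of 0] by (intro mult_nonneg_nonneg) auto
    ultimately have "(C * norm \<psi>)-lipschitz_on UNIV (\<lambda>t. U t \<psi>)"
      by (intro lipschitz_onI) (auto simp: dist_norm)
    then show ?thesis
      by (rule lipschitz_on_continuous_on)
  qed
  with unitary id add show ?thesis
    by (simp add: unitary_group_def)
qed

section \<open>The Hamiltonian\<close>

text \<open>Translations are isometries and \<open>K\<close> is absolutely summable, so the weighted
  translates of \<psi> sum to a vector \<open>S\<close>. Evaluating coordinates, which is
  continuous, identifies the convolution with the coordinates of \<open>S\<close>.\<close>

lemma
  assumes K: "(\<lambda>\<alpha>. cmod (K \<alpha>)) summable_on UNIV"
  shows hamiltonian_has_sum: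
      "((\<lambda>\<alpha>. cscale (of_real h) (cscale (K \<alpha>) (shift \<alpha> \<psi>))) has_sum hamiltonian h K \<psi>) UNIV"
    and coord_hamiltonian: "coord (hamiltonian h K \<psi>) = hop_seq h K (coord \<psi>)"
    and summable_hop: "(\<lambda>\<alpha>. K \<alpha> * coord \<psi> (n - \<alpha>)) summable_on UNIV"
proof -
  have "(\<lambda>\<alpha>. cscale (K \<alpha>) (shift \<alpha> \<psi>)) summable_on UNIV"
    by (rule abs_summable_summable) (simp add: norm_cscale norm_shift summable_on_cmult_left K)
  then obtain S where S: "((\<lambda>\<alpha>. cscale (K \<alpha>) (shift \<alpha> \<psi>)) has_sum S) UNIV"
    by (auto simp: summable_on_def)
  have coord: "((\<lambda>\<alpha>. K \<alpha> * coord \<psi> (n - \<alpha>)) has_sum coord S n) UNIV" for n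
    using has_sum_bounded_linear[OF bounded_linear_coord S, of n] by (simp add: shift.rep_eq)
  then show "(\<lambda>\<alpha>. K \<alpha> * coord \<psi> (n - \<alpha>)) summable_on UNIV"
    by (auto simp: summable_on_def)
  have "hop_seq h K (coord \<psi>) = coord (cscale (of_real h) S)"
    by (rule ext) (simp add: hop_seq_def infsumI[OF coord])
  \<comment> \<open>The sequence under \<open>Abs_ell2\<close> is now known to be the coordinate
    sequence of a vector, so \<open>Abs_ell2\<close> returns that vector.\<close>
  then have eq: "hamiltonian h K \<psi> = cscale (of_real h) S"
    by (simp only: hamiltonian_def coord_inverse)
  with \<open>hop_seq h K (coord \<psi>) = _\<close> show "coord (hamiltonian h K \<psi>) = hop_seq h K (coord \<psi>)"
    by simp
  show "((\<lambda>\<alpha>. cscale (of_real h) (cscale (K \<alpha>) (shift \<alpha> \<psi>))) has_sum hamiltonian h K \<psi>) UNIV"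
    unfolding eq by (rule has_sum_bounded_linear[OF bounded_linear_cscale S])
qed

section \<open>The dispersion relation\<close>

lemma dispersion_uniform_limit:
  assumes K: "(\<lambda>\<alpha>. cmod (K \<alpha>)) summable_on UNIV"
  shows "uniform_limit UNIV (\<lambda>F k. \<Sum>\<alpha>\<in>F. of_real h * (K \<alpha> * exp (- (\<i> * of_real k * of_int \<alpha>))))
    (dispersion h K) (finite_subsets_at_top UNIV)"
proof -
  have "uniform_limit UNIV (\<lambda>F k. \<Sum>\<alpha>\<in>F. of_real h * (K \<alpha> * exp (- (\<i> * of_real k * of_int \<alpha>))))
    (\<lambda>k. \<Sum>\<^sub>\<infinity>\<alpha>. of_real h * (K \<alpha> * exp (- (\<i> * of_real k * of_int \<alpha>)))) (finite_subsets_at_top UNIV)"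
    \<comment> \<open>The exponentials have modulus one, so the majorant does not depend on
      \<open>k\<close>.\<close>
    by (rule Weierstrass_m_test_general[where M = "\<lambda>\<alpha>. \<bar>h\<bar> * cmod (K \<alpha>)"])
      (auto simp: norm_mult intro: summable_on_cmult_right K)
  then show ?thesis
    by (simp add: dispersion_def[abs_def] infsum_cmult_right')
qed

lemma continuous_dispersion:
  assumes "(\<lambda>\<alpha>. cmod (K \<alpha>)) summable_on UNIV"
  shows "continuous_on UNIV (dispersion h K)"
  by (rule uniform_limit_theorem[OF always_eventually dispersion_uniform_limit[OF assms]])
    (auto intro!: continuous_intros)

lemma norm_dispersion_le:
  assumes "(\<lambda>\<alpha>. cmod (K \<alpha>)) summable_on UNIV" "h \<ge> 0"
  shows "cmod (dispersion h K k) \<le> h * (\<Sum>\<^sub>\<infinity>\<alpha>. cmod (K \<alpha>))"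
proof -
  have "(\<lambda>\<alpha>. norm (K \<alpha> * exp (- (\<i> * of_real k * of_int \<alpha>)))) summable_on UNIV"
    using assms(1) by (simp add: norm_mult)
  from norm_infsum_bound[OF this] show ?thesis
    using assms(2) by (simp add: dispersion_def norm_mult mult_left_mono)
qed

text \<open>Conjugation replaces \<alpha> by its negative in the exponent, and the symmetry of the
  real coefficients allows the sum to be reindexed back.\<close>

lemma dispersion_real:
  assumes "\<And>\<alpha>. K (- \<alpha>) = K \<alpha>" "\<And>\<alpha>. K \<alpha> \<in> \<real>"
  shows "dispersion h K k \<in> \<real>"
proof -
  let ?e = "\<lambda>\<alpha>. K \<alpha> * exp (- (\<i> * of_real k * of_int \<alpha>))"
  have "cnj (infsum ?e UNIV) = (\<Sum>\<^sub>\<infinity>\<alpha>. cnj (?e \<alpha>))"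
    by (rule infsum_cnj[symmetric])
  also have "\<dots> = (\<Sum>\<^sub>\<infinity>\<alpha>. ?e (- \<alpha>))"
    using assms by (simp add: exp_cnj Reals_cnj_iff)
  also have "\<dots> = infsum ?e UNIV"
    by (rule infsum_reindex_bij_witness[where i = uminus and j = uminus]) auto
  finally show ?thesis
    by (simp add: dispersion_def Reals_cnj_iff)
qed

lemma dispersion_periodic: "dispersion h K (k + 2 * pi) = dispersion h K k"
proof -
  have "exp (- (\<i> * of_real (k + 2 * pi) * of_int \<alpha>)) = exp (- (\<i> * of_real k * of_int \<alpha>))" for \<alpha> :: int
    \<comment> \<open>The exponents differ by \<open>-\<alpha>\<close> multiples of the period of
      \<open>exp\<close>.\<close>
    unfolding exp_eq by (intro exI[of _ "- \<alpha>"]) (simp add: algebra_simps)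
  then show ?thesis
    by (simp only: dispersion_def)
qed

section \<open>The Hamiltonian and its evolution as multipliers\<close>

lemma fourier_multiplier_hamiltonian:
  assumes K: "(\<lambda>\<alpha>. cmod (K \<alpha>)) summable_on UNIV"
  shows "fourier_multiplier (hamiltonian h K) (dispersion h K)"
proof (rule fourier_multiplier_limit[OF _ _ dispersion_uniform_limit[OF K]])
  show "fourier_multiplier (\<lambda>\<psi>. \<Sum>\<alpha>\<in>F. cscale (of_real h) (cscale (K \<alpha>) (shift \<alpha> \<psi>)))
      (\<lambda>k. \<Sum>\<alpha>\<in>F. of_real h * (K \<alpha> * exp (- (\<i> * of_real k * of_int \<alpha>))))" for F
    by (intro fourier_multiplier_sum fourier_multiplier_cscale fourier_multiplier_shift)
  show "((\<lambda>F. \<Sum>\<alpha>\<in>F. cscale (of_real h) (cscale (K \<alpha>) (shift \<alpha> \<psi>))) \<longlongrightarrow> hamiltonian h K \<psi>)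
      (finite_subsets_at_top UNIV)" for \<psi>
    using hamiltonian_has_sum[OF K] by (simp add: has_sum_def)
  show "dispersion h K \<in> borel_measurable borel"
    by (intro borel_measurable_continuous_onI continuous_dispersion K)
qed simp

lemma fourier_multiplier_evolution:
  assumes K: "(\<lambda>\<alpha>. cmod (K \<alpha>)) summable_on UNIV"
  shows "fourier_multiplier (evolution h K t)
    (\<lambda>k. exp (- (\<i> / of_real h) * dispersion h K k * of_real t))"
proof -
  let ?A = "\<lambda>\<psi>. cscale (- (\<i> / of_real h) * of_real t) (hamiltonian h K \<psi>)"
  have A: "fourier_multiplier ?A (\<lambda>k. - (\<i> / of_real h) * of_real t * dispersion h K k)"
    by (intro fourier_multiplier_cscale fourier_multiplier_hamiltonian K)
  \<comment> \<open>A multiplier is bounded linear, which makes \<open>Blinfun\<close> in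
    \<open>generator\<close> faithful.\<close>
  then have "blinfun_apply (generator h K t) = ?A"
    unfolding generator_def
    by (intro bounded_linear_Blinfun_apply) (auto dest: fourier_multiplier_bounded_clinear simp: bounded_clinear_def)
  with A show ?thesis
    using fourier_multiplier_op_exp[of "generator h K t"]
    by (simp add: evolution_def[abs_def] mult_ac)
qed

text \<open>The summability clauses and the coordinate formula belong to the conclusion because
  infinite sums and \<open>Abs_ell2\<close> are total functions: these clauses certify that the
  values are the intended ones.\<close>

theorem proposition2p4:
  fixes h :: real and K :: "int \<Rightarrow> complex"
  assumes "h > 0"
    and "(\<lambda>\<alpha>. cmod (K \<alpha>)) summable_on UNIV"
    and "\<And>\<alpha>. K (- \<alpha>) = K \<alpha>"
    and "\<And>\<alpha>. K \<alpha> \<in> \<real>"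
  shows
    "((\<forall>\<psi> n. (\<lambda>\<alpha>. K \<alpha> * coord \<psi> (n - \<alpha>)) summable_on UNIV) \<and>
      (\<forall>\<psi> n. coord (hamiltonian h K \<psi>) n = hop_seq h K (coord \<psi>) n) \<and>
      bounded_clinear (hamiltonian h K) \<and>
      onorm (hamiltonian h K) \<le> h * (\<Sum>\<^sub>\<infinity>\<alpha>. cmod (K \<alpha>)) \<and>
      selfadjoint (hamiltonian h K)) \<and>
     ((\<forall>\<psi>. AE k in circle.
         fourier (hamiltonian h K \<psi>) k = dispersion h K k * fourier \<psi> k) \<and>
      (\<forall>k. dispersion h K k \<in> \<real>) \<and>
      continuous_on UNIV (dispersion h K) \<and>
      (\<forall>k. dispersion h K (k + 2 * pi) = dispersion h K k)) \<and>
     ((\<forall>t. summable (exp_term (generator h K t))) \<and>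
      unitary_group (evolution h K) \<and>
      (\<forall>t \<psi>. AE k in circle.
         fourier (evolution h K t \<psi>) k
           = exp (- (\<i> / of_real h) * dispersion h K k * of_real t) * fourier \<psi> k) \<and>
      (\<forall>t n m n' m'. n - m = n' - m' \<longrightarrow> prop_kernel h K t n m = prop_kernel h K t n' m') \<and>
      (\<forall>t n m. prop_kernel h K t n m
         = 1 / (2 * of_real pi) *
           integral {-pi..pi} (\<lambda>k. exp (\<i> * of_real k * of_int (n - m)) *
             exp (- (\<i> / of_real h) * dispersion h K k * of_real t))))"
proof (intro conjI allI impI)
  note K = assms(2)
  let ?C = "\<Sum>\<^sub>\<infinity>\<alpha>. cmod (K \<alpha>)"
  note H = fourier_multiplier_hamiltonian[OF K, of h]
  note U = fourier_multiplier_evolution[OF K, of h]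
  note real = dispersion_real[of K h, OF assms(3,4)]
  note bound = norm_dispersion_le[OF K less_imp_le[OF assms(1)]]
  show "(\<lambda>\<alpha>. K \<alpha> * coord \<psi> (n - \<alpha>)) summable_on UNIV" for \<psi> n
    by (rule summable_hop[OF K])
  show "coord (hamiltonian h K \<psi>) n = hop_seq h K (coord \<psi>) n" for \<psi> n
    by (simp only: coord_hamiltonian[OF K])
  show clinear: "bounded_clinear (hamiltonian h K)"
    by (rule fourier_multiplier_bounded_clinear[OF H])
  show "onorm (hamiltonian h K) \<le> h * ?C"
    by (rule onorm_bound[OF _ fourier_multiplier_norm_le[OF H bound]])
      (simp add: assms(1) less_imp_le infsum_nonneg)
  \<comment> \<open>A real multiplier is its own conjugate, so \<open>hamiltonian h K\<close> serves
    as its own adjoint.\<close>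
  have "(\<lambda>k. cnj (dispersion h K k)) = dispersion h K"
    using real by (simp add: Reals_cnj_iff)
  with H have "cinner \<phi> (hamiltonian h K \<psi>) = cinner (hamiltonian h K \<phi>) \<psi>" for \<phi> \<psi>
    by (intro fourier_multiplier_adjoint[OF H]) simp
  with clinear show "selfadjoint (hamiltonian h K)"
    by (simp add: selfadjoint_def)
  show "AE k in circle. fourier (hamiltonian h K \<psi>) k = dispersion h K k * fourier \<psi> k" for \<psi>
    by (rule fourier_multiplierD(2)[OF H])
  show "dispersion h K k \<in> \<real>" for k
    by (rule real)
  show "continuous_on UNIV (dispersion h K)"
    by (rule continuous_dispersion[OF K])
  show "dispersion h K (k + 2 * pi) = dispersion h K k" for k
    by (rule dispersion_periodic)
  show "summable (exp_term (generator h K t))" for t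
    by (rule summable_exp_term)
  show "unitary_group (evolution h K)"
  proof (rule unitary_group_multiplier)
    \<comment> \<open>The frequency is \<open>-E / h\<close>; taking the real part only changes the
      type, because \<open>E\<close> is real.\<close>
    let ?w = "\<lambda>k. - (Re (dispersion h K k) / h)"
    show "fourier_multiplier (evolution h K t) (\<lambda>k. exp (\<i> * of_real (?w k * t)))" for t
    proof -
      have "\<i> * of_real (?w k * t) = - (\<i> / of_real h) * dispersion h K k * of_real t" for k
        using of_real_Re[OF real[of k]] by (simp add: field_simps)
      then show ?thesis
        by (simp only: U)
    qed
    \<comment> \<open>The factor \<open>h\<close> in the bound on \<open>E\<close> cancels, leaving
      the sum of \<open>cmod (K \<alpha>)\<close>.\<close>
    show "\<bar>?w k\<bar> \<le> ?C" for k
      using order_trans[OF abs_Re_le_cmod bound] assms(1) by (simp add: field_simps)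
  qed
  show "AE k in circle. fourier (evolution h K t \<psi>) k
      = exp (- (\<i> / of_real h) * dispersion h K k * of_real t) * fourier \<psi> k" for t \<psi>
    by (rule fourier_multiplierD(2)[OF U])
  show kernel: "prop_kernel h K t n m = 1 / (2 * of_real pi) *
      integral {-pi..pi} (\<lambda>k. exp (\<i> * of_real k * of_int (n - m)) *
        exp (- (\<i> / of_real h) * dispersion h K k * of_real t))" for t n m
    unfolding prop_kernel_def
    by (intro fourier_multiplier_kernel U continuous_intros continuous_dispersion K)
  show "prop_kernel h K t n m = prop_kernel h K t n' m'" if "n - m = n' - m'" for t n m n' m'
    by (simp only: kernel that)
qed

end
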